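(* Let $\mathfrak{L}$ be a left Leibniz algebra over a field $\mathbb{F}$, and let $M$ be an $\mathfrak{L}$-bimodule. Let $S$ be a subset of $\mathfrak{L}$ such that (i) the operator $L_s:\mathfrak{L}\to\mathfrak{L}$, $x\mapsto sx$, is locally nilpotent for every $s\in S$, and (ii) $\dim_{\mathbb{F}}M/M_0(S)<\infty$. Then $\mathrm{HL}^n(\mathfrak{L},M)\cong\mathrm{HL}^n(\mathfrak{L},M_0(S))$ as $\mathbb{F}$-vector spaces for every integer $n\ge 2$. Moreover, if $M$ is symmetric, then $\mathrm{HL}^n(\mathfrak{L},M)\cong\mathrm{HL}^n(\mathfrak{L},M_0(S))$ for every non-negative integer $n$.
   Context: A left Leibniz algebra over a field $\mathbb{F}$ is an $\mathbb{F}$-vector space $\mathfrak{L}$ (of arbitrary dimension) with a bilinear multiplication satisfying $x(yz)=(xy)z+y(xz)$ for all $x,y,z\in\mathfrak{L}$. An $\mathfrak{L}$-bimodule is an $\mathbb{F}$-vector space $M$ with bilinear left and right actions of $\mathfrak{L}$ such that $(xy)\cdot m=x\cdot(y\cdot m)-y\cdot(x\cdot m)$, $(x\cdot m)\cdot y=x\cdot(m\cdot y)-m\cdot(xy)$, and $(m\cdot x)\cdot y=m\cdot(xy)-x\cdot(m\cdot y)$ for all $m\in M$, $x,y\in\mathfrak{L}$. $M$ is symmetric if $m\cdot x=-x\cdot m$ for all $x\in\mathfrak{L}$, $m\in M$. Write $\lambda_x(m)=x\cdot m$. A linear operator $T$ on a vector space $V$ is locally nilpotent if every $v\in V$ is annihilated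 by some power of $T$. $M_0(S):=\bigcap_{s\in S}M_0(\lambda_s)$, where $M_0(\lambda_s):=\bigcup_{n\ge 1}\operatorname{Ker}(\lambda_s^n)$ (and $M_0(\emptyset)=M$); under hypothesis (i), $M_0(S)$ is an $\mathfrak{L}$-subbimodule of $M$. Leibniz cohomology: for $n\ge 0$ let $\mathrm{CL}^n(\mathfrak{L},M):=\mathrm{Hom}_{\mathbb{F}}(\mathfrak{L}^{\otimes n},M)$ and $\mathrm{d}^n:\mathrm{CL}^n(\mathfrak{L},M)\to\mathrm{CL}^{n+1}(\mathfrak{L},M)$, $$(\mathrm{d}^nf)(x_1\otimes\dots\otimes x_{n+1})=\sum_{j=1}^n(-1)^{j+1}x_j\cdot f(x_1\otimes\dots\otimes\hat{x}_j\otimes\dots\otimes x_{n+1})+(-1)^{n+1}f(x_1\otimes\dots\otimes x_n)\cdot x_{n+1}+\sum_{1\le i<j\le n+1}(-1)^if(x_1\otimes\dots\otimes\hat{x}_i\otimes\dots\otimes x_{j-1}\otimes x_ix_j\otimes x_{j+1}\otimes\dots\otimes x_{n+1}).$$ This is a cochain complex, and $\mathrm{HL}^n(\mathfrak{L},M):=\operatorname{Ker}(\mathrm{d}^n)/\operatorname{Im}(\mathrm{d}^{n-1})$ with $\mathrm{d}^{-1}:=0$. *)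

theory Defs
  imports
    "HOL-Library.Function_Algebras"
    "Jordan_Normal_Form.VS_Connect"
begin

section \<open>Leibniz algebras and bimodules\<close>

locale left_leibniz_algebra = Vector_Spaces.vector_space scaleL
  for scaleL :: "'f::field \<Rightarrow> 'l::ab_group_add \<Rightarrow> 'l" +
  fixes lmul :: "'l \<Rightarrow> 'l \<Rightarrow> 'l"
  assumes linear_lmul_right: "\<And>x. Vector_Spaces.linear scaleL scaleL (\<lambda>y. lmul x y)"
    and linear_lmul_left: "\<And>y. Vector_Spaces.linear scaleL scaleL (\<lambda>x. lmul x y)"
    and leibniz: "\<And>x y z. lmul x (lmul y z) = lmul (lmul x y) z + lmul y (lmul x z)"

locale leibniz_bimodule =
  L: left_leibniz_algebra scaleL lmul + M: Vector_Spaces.vector_space scaleM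
  for scaleL :: "'f::field \<Rightarrow> 'l::ab_group_add \<Rightarrow> 'l"
    and lmul :: "'l \<Rightarrow> 'l \<Rightarrow> 'l"
    and scaleM :: "'f \<Rightarrow> 'm::ab_group_add \<Rightarrow> 'm" +
  fixes lact :: "'l \<Rightarrow> 'm \<Rightarrow> 'm"
    and ract :: "'m \<Rightarrow> 'l \<Rightarrow> 'm"
  assumes linear_lact_module: "\<And>x. Vector_Spaces.linear scaleM scaleM (\<lambda>m. lact x m)"
    and linear_lact_algebra: "\<And>m. Vector_Spaces.linear scaleL scaleM (\<lambda>x. lact x m)"
    and linear_ract_module: "\<And>x. Vector_Spaces.linear scaleM scaleM (\<lambda>m. ract m x)"
    and linear_ract_algebra: "\<And>m. Vector_Spaces.linear scaleL scaleM (\<lambda>x. ract m x)"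
    and LLM: "\<And>x y m. lact (lmul x y) m = lact x (lact y m) - lact y (lact x m)"
    and LML: "\<And>x y m. ract (lact x m) y = lact x (ract m y) - ract m (lmul x y)"
    and MLL: "\<And>x y m. ract (ract m x) y = ract m (lmul x y) - lact x (ract m y)"

definition symmetric_bimodule :: "('l \<Rightarrow> 'm \<Rightarrow> 'm) \<Rightarrow> ('m \<Rightarrow> 'l \<Rightarrow> 'm::ab_group_add) \<Rightarrow> bool" where
  "symmetric_bimodule lact ract \<longleftrightarrow> (\<forall>x m. ract m x = - lact x m)"

definition locally_nilpotent :: "('v \<Rightarrow> 'v::zero) \<Rightarrow> bool" where
  "locally_nilpotent T \<longleftrightarrow> (\<forall>v. \<exists>n. (T ^^ n) v = 0)"

definition fitting_null :: "('v \<Rightarrow> 'v::zero) \<Rightarrow> 'v set" where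
  "fitting_null T = (\<Union>n\<in>{1..}. {v. (T ^^ n) v = 0})"

definition fitting_null_set :: "('l \<Rightarrow> 'm \<Rightarrow> 'm::zero) \<Rightarrow> 'l set \<Rightarrow> 'm set" where
  "fitting_null_set lact S = (\<Inter>s\<in>S. fitting_null (lact s))"

section \<open>Quotient vector spaces\<close>

definition vcoset :: "'v::ab_group_add set \<Rightarrow> 'v \<Rightarrow> 'v set" where
  "vcoset W v = (\<lambda>w. v + w) ` W"

text \<open>The quotient of a subspace \<open>V\<close> by a subspace \<open>W\<close>, as a module record over the field
  \<open>class_ring\<close>.  Adding \<open>W\<close> in the scalar multiplication matters only for the scalar \<open>0\<close>.
  The ring multiplication and unit of the record are junk, as usual for module records.\<close>

definition quotient_space ::
  "('f::field \<Rightarrow> 'v::ab_group_add \<Rightarrow> 'v) \<Rightarrow> 'v set \<Rightarrow> 'v set \<Rightarrow> ('f, 'v set) module" where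
  "quotient_space scale V W =
     \<lparr>carrier = vcoset W ` V,
      mult = undefined,
      one = undefined,
      zero = W,
      add = (\<lambda>X Y. {x + y | x y. x \<in> X \<and> y \<in> Y}),
      smult = (\<lambda>c X. {scale c x + w | x w. x \<in> X \<and> w \<in> W})\<rparr>"

lemma vectorspace_quotient_space:
  assumes vs: "Vector_Spaces.vector_space scale"
    and V: "Modules.module.subspace scale V" and W: "Modules.module.subspace scale W"
  shows "vectorspace class_ring (quotient_space scale V W)"
proof -
  interpret v: Vector_Spaces.vector_space scale by fact
  let ?Q = "quotient_space scale V W"
  have W0: "0 \<in> W" "\<And>a b. a\<in>W \<Longrightarrow> b\<in>W \<Longrightarrow> a+b\<in>W" "\<And>a b. a\<in>W \<Longrightarrow> b\<in>W \<Longrightarrow> a-b\<in>W" "\<And>c a. a\<in>W \<Longrightarrow> scale c a\<in>W"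
    using W v.subspace_0 v.subspace_add v.subspace_diff v.subspace_scale by blast+
  have mem: "x \<in> vcoset W a \<longleftrightarrow> x - a \<in> W" for x a
    unfolding vcoset_def by (auto simp: image_iff intro!: bexI[of _ "x - a"])
  have add: "{x + y | x y. x \<in> vcoset W a \<and> y \<in> vcoset W b} = vcoset W (a+b)" for a b
  proof (intro Set.set_eqI iffI)
    fix x assume "x \<in> vcoset W (a+b)"
    then have "x = a + (x - a)" "a \<in> vcoset W a" "x - a \<in> vcoset W b"
      using W0(1) by (auto simp: mem algebra_simps)
    then show "x \<in> {x + y | x y. x \<in> vcoset W a \<and> y \<in> vcoset W b}" by blast
  next
    fix x assume "x \<in> {x + y | x y. x \<in> vcoset W a \<and> y \<in> vcoset W b}"
    then obtain y z where "x = y + z" "y - a \<in> W" "z - b \<in> W" by (auto simp: mem)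
    then have "x - (a+b) = (y-a)+(z-b)" by simp
    then show "x \<in> vcoset W (a+b)" using \<open>y - a \<in> W\<close> \<open>z - b \<in> W\<close> W0(2)[of "y-a" "z-b"] unfolding mem by metis
  qed
  have sc: "{scale c x + w | x w. x \<in> vcoset W a \<and> w \<in> W} = vcoset W (scale c a)" for a c
  proof (intro Set.set_eqI iffI)
    fix x assume "x \<in> vcoset W (scale c a)"
    then have "x = scale c a + (x - scale c a)" "a \<in> vcoset W a" "x - scale c a \<in> W"
      using W0(1) by (auto simp: mem algebra_simps)
    then show "x \<in> {scale c x + w | x w. x \<in> vcoset W a \<and> w \<in> W}" by blast
  next
    fix x assume "x \<in> {scale c x + w | x w. x \<in> vcoset W a \<and> w \<in> W}"
    then obtain y w where *: "x = scale c y + w" "y - a \<in> W" "w \<in> W" by (auto simp: mem)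
    then have "x - scale c a = scale c (y - a) + w" by (simp add: v.scale_right_diff_distrib)
    then show "x \<in> vcoset W (scale c a)" using * W0(2)[OF W0(4)] unfolding mem by metis
  qed
  have W': "W = vcoset W 0" by (auto simp: vcoset_def)
  have V0: "0 \<in> V" "\<And>a b. a\<in>V \<Longrightarrow> b\<in>V \<Longrightarrow> a+b\<in>V" "\<And>c a. a\<in>V \<Longrightarrow> scale c a\<in>V" "\<And>a. a\<in>V \<Longrightarrow> -a\<in>V"
    using V v.subspace_0 v.subspace_add v.subspace_neg v.subspace_scale by blast+
  have [simp]: "carrier ?Q = vcoset W ` V" "zero ?Q = vcoset W 0"
    "\<And>a b. add ?Q (vcoset W a) (vcoset W b) = vcoset W (a+b)"
    "\<And>a c. smult ?Q c (vcoset W a) = vcoset W (scale c a)"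
    by (simp_all add: quotient_space_def add sc W'[symmetric])
  have "abelian_group ?Q"
    apply (rule abelian_groupI)
    using V0 apply (auto simp: algebra_simps)
    by (metis add.right_inverse)
  then have "Module.module class_ring ?Q"
    apply (intro moduleI)
    using V0 by (auto simp: v.scale_left_distrib v.scale_right_distrib class_cring.is_cring)
  then show ?thesis
    unfolding vectorspace_def using class_field by blast
qed

definition vs_isomorphic :: "('f::field, 'u) module \<Rightarrow> ('f, 'w) module \<Rightarrow> bool" where
  "vs_isomorphic V W \<longleftrightarrow>
     (\<exists>\<phi>. linear_map class_ring V W \<phi> \<and> bij_betw \<phi> (carrier V) (carrier W))"

section \<open>Leibniz cohomology\<close>

text \<open>A linear map from the \<open>n\<close>-th tensor power of the algebra to a subspace \<open>N\<close> of the module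
  is represented by the corresponding \<open>n\<close>-linear map, i.e. by its values on the elementary tensors
  given by lists of length \<open>n\<close>.  It is extended by \<open>0\<close> to lists of other lengths, so that equality
  of cochains is equality of functions.  For \<open>n = 0\<close> a cochain is its value at \<open>[]\<close>.\<close>

definition cochains ::
  "('f::field \<Rightarrow> 'l::ab_group_add \<Rightarrow> 'l) \<Rightarrow> ('f \<Rightarrow> 'm::ab_group_add \<Rightarrow> 'm) \<Rightarrow> nat \<Rightarrow> 'm set
     \<Rightarrow> ('l list \<Rightarrow> 'm) set" where
  "cochains scaleL scaleM n N =
     {f. (\<forall>xs. length xs = n \<longrightarrow> f xs \<in> N) \<and>
         (\<forall>xs. length xs \<noteq> n \<longrightarrow> f xs = 0) \<and>
         (\<forall>xs i. length xs = n \<longrightarrow> i < n \<longrightarrow>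
            Vector_Spaces.linear scaleL scaleM (\<lambda>x. f (xs[i := x])))}"

definition omit :: "nat \<Rightarrow> 'l list \<Rightarrow> 'l list" where
  "omit i xs = take i xs @ drop (Suc i) xs"

text \<open>The differential from degree \<open>n\<close> to degree \<open>n + 1\<close>.  List positions are counted from \<open>0\<close>,
  so for the usual indices starting at \<open>1\<close> the signs \<open>(-1)^(j+1)\<close> and \<open>(-1)^i\<close> become
  \<open>(-1)^j\<close> and \<open>(-1)^(i+1)\<close>.\<close>

definition leibniz_d ::
  "('l \<Rightarrow> 'l \<Rightarrow> 'l) \<Rightarrow> ('f::field \<Rightarrow> 'm::ab_group_add \<Rightarrow> 'm) \<Rightarrow> ('l \<Rightarrow> 'm \<Rightarrow> 'm) \<Rightarrow> ('m \<Rightarrow> 'l \<Rightarrow> 'm)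
     \<Rightarrow> nat \<Rightarrow> ('l list \<Rightarrow> 'm) \<Rightarrow> 'l list \<Rightarrow> 'm" where
  "leibniz_d lmul scaleM lact ract n f xs =
     (if length xs = Suc n then
        (\<Sum>j<n. scaleM ((-1) ^ j) (lact (xs ! j) (f (omit j xs))))
        + scaleM ((-1) ^ (n + 1)) (ract (f (take n xs)) (xs ! n))
        + (\<Sum>j<Suc n. \<Sum>i<j.
             scaleM ((-1) ^ (i + 1)) (f (omit i (xs[j := lmul (xs ! i) (xs ! j)]))))
      else 0)"

text \<open>The cohomology in degree \<open>n\<close> with values in the subbimodule \<open>N\<close> of the module
  (the whole module is \<open>N = UNIV\<close>).\<close>

definition cocycles ::
  "('f::field \<Rightarrow> 'l::ab_group_add \<Rightarrow> 'l) \<Rightarrow> ('l \<Rightarrow> 'l \<Rightarrow> 'l) \<Rightarrow> ('f \<Rightarrow> 'm::ab_group_add \<Rightarrow> 'm)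
     \<Rightarrow> ('l \<Rightarrow> 'm \<Rightarrow> 'm) \<Rightarrow> ('m \<Rightarrow> 'l \<Rightarrow> 'm) \<Rightarrow> nat \<Rightarrow> 'm set \<Rightarrow> ('l list \<Rightarrow> 'm) set" where
  "cocycles scaleL lmul scaleM lact ract n N =
     {f \<in> cochains scaleL scaleM n N. leibniz_d lmul scaleM lact ract n f = 0}"

definition coboundaries ::
  "('f::field \<Rightarrow> 'l::ab_group_add \<Rightarrow> 'l) \<Rightarrow> ('l \<Rightarrow> 'l \<Rightarrow> 'l) \<Rightarrow> ('f \<Rightarrow> 'm::ab_group_add \<Rightarrow> 'm)
     \<Rightarrow> ('l \<Rightarrow> 'm \<Rightarrow> 'm) \<Rightarrow> ('m \<Rightarrow> 'l \<Rightarrow> 'm) \<Rightarrow> nat \<Rightarrow> 'm set \<Rightarrow> ('l list \<Rightarrow> 'm) set" where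
  "coboundaries scaleL lmul scaleM lact ract n N =
     (case n of
        0 \<Rightarrow> {0}
      | Suc k \<Rightarrow> leibniz_d lmul scaleM lact ract k ` cochains scaleL scaleM k N)"

definition HL ::
  "('f::field \<Rightarrow> 'l::ab_group_add \<Rightarrow> 'l) \<Rightarrow> ('l \<Rightarrow> 'l \<Rightarrow> 'l) \<Rightarrow> ('f \<Rightarrow> 'm::ab_group_add \<Rightarrow> 'm)
     \<Rightarrow> ('l \<Rightarrow> 'm \<Rightarrow> 'm) \<Rightarrow> ('m \<Rightarrow> 'l \<Rightarrow> 'm) \<Rightarrow> nat \<Rightarrow> 'm set \<Rightarrow> ('f, ('l list \<Rightarrow> 'm) set) module"
  where
  "HL scaleL lmul scaleM lact ract n N =
     quotient_space (\<lambda>c f xs. scaleM c (f xs))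
       (cocycles scaleL lmul scaleM lact ract n N)
       (coboundaries scaleL lmul scaleM lact ract n N)"

end

theory Submission
  imports Defs
begin

text \<open>Cartan's formula shows that \<open>lie s\<close>, the operator induced by \<open>s\<close> on cochains, is null-homotopic in
  positive degrees. It is the action of \<open>s\<close> on the values minus an operator coming from \<open>L\<^sub>s\<close>, which is
  locally nilpotent when \<open>L\<^sub>s\<close> is. Modulo the subbimodule \<open>N \<inter> M\<^sub>0(s)\<close> of \<open>N\<close>, of finite codimension,
  \<open>s\<close> acts injectively and hence bijectively, so \<open>lie s\<close> is invertible there and the cohomology of the
  quotient vanishes in positive degrees. Cutting down \<open>M\<close> by one element of \<open>S\<close> after another reaches
  \<open>M\<^sub>0(S)\<close> after finitely many steps, since the dimension drops each time. The comparison of cohomology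
  is the long exact sequence, written out for cochains of \<open>M\<close> whose differential takes values in
  \<open>M\<^sub>0(S)\<close>; in the symmetric case it extends to degree zero because \<open>s \<cdot> m \<in> M\<^sub>0(s)\<close> implies
  \<open>m \<in> M\<^sub>0(s)\<close>.\<close>

section \<open>Summing a multilinear map over its slots\<close>

text \<open>This is \<open>f\<close> composed with the derivation of the tensor algebra that extends
  \<open>T\<close>. The recursion peels off the first argument, so identities can be proved by
  contraction.\<close>

primrec slot_sum :: "('l \<Rightarrow> 'l) \<Rightarrow> ('l list \<Rightarrow> 'm::ab_group_add) \<Rightarrow> 'l list \<Rightarrow> 'm" where
  "slot_sum T f [] = 0"
| "slot_sum T f (x # xs) = f (T x # xs) + slot_sum T (\<lambda>ys. f (x # ys)) xs"

lemma slot_sum_add: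
  "slot_sum T (\<lambda>ys. f ys + g ys) xs = slot_sum T f xs + slot_sum T g xs"
proof (induction xs arbitrary: f g)
  case (Cons x xs)
  show ?case
    unfolding slot_sum.simps Cons.IH[of "\<lambda>ys. f (x # ys)" "\<lambda>ys. g (x # ys)"] by simp
qed simp

lemma slot_sum_zero: "slot_sum T (\<lambda>ys. 0) xs = 0"
  by (induction xs) auto

lemma slot_sum_diff:
  "slot_sum T (\<lambda>ys. f ys - g ys) xs = slot_sum T f xs - slot_sum T g xs"
proof (induction xs arbitrary: f g)
  case (Cons x xs)
  show ?case
    unfolding slot_sum.simps Cons.IH[of "\<lambda>ys. f (x # ys)" "\<lambda>ys. g (x # ys)"] by simp
qed simp

lemma slot_sum_linear:
  assumes "\<And>a b. h (a + b) = h a + h b" "h 0 = 0"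
  shows "slot_sum T (\<lambda>ys. h (f ys)) xs = h (slot_sum T f xs)"
proof (induction xs arbitrary: f)
  case (Cons x xs)
  show ?case
    unfolding slot_sum.simps Cons.IH[of "\<lambda>ys. f (x # ys)"] assms by simp
qed (simp add: assms)

lemma slot_sum_cong:
  "(\<And>ys. length ys = length xs \<Longrightarrow> f ys = g ys) \<Longrightarrow> slot_sum T f xs = slot_sum T g xs"
proof (induction xs arbitrary: f g)
  case (Cons x xs)
  have "slot_sum T (\<lambda>ys. f (x # ys)) xs = slot_sum T (\<lambda>ys. g (x # ys)) xs"
    by (rule Cons.IH) (simp add: Cons.prems)
  then show ?case by (simp add: Cons.prems)
qed simp

lemma slot_sum_eq_sum:
  "slot_sum T f xs = (\<Sum>i<length xs. f (xs[i := T (xs ! i)]))"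
proof (induction xs arbitrary: f)
  case (Cons x xs)
  show ?case
    unfolding slot_sum.simps Cons.IH[of "\<lambda>ys. f (x # ys)"]
    by (simp add: sum.lessThan_Suc_shift del: sum.lessThan_Suc)
qed simp

section \<open>Multilinear cochains and operators on their slots\<close>

context leibniz_bimodule
begin

abbreviation "C \<equiv> cochains scaleL scaleM"

lemma linear_iff_LM:
  "Vector_Spaces.linear scaleL scaleM g \<longleftrightarrow>
     (\<forall>x y. g (x + y) = g x + g y) \<and> (\<forall>c x. g (scaleL c x) = scaleM c (g x))"
  unfolding Vector_Spaces.linear_iff
  using L.vector_space_axioms M.vector_space_axioms by simp

lemma lmul_simps:
  "lmul x (y + z) = lmul x y + lmul x z" "lmul x (scaleL c y) = scaleL c (lmul x y)"
  "lmul (x + y) z = lmul x z + lmul y z" "lmul (scaleL c x) z = scaleL c (lmul x z)"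
  using L.linear_lmul_right[of x] L.linear_lmul_left[of z]
  unfolding Vector_Spaces.linear_iff by auto

lemma lact_simps:
  "lact x (m + m') = lact x m + lact x m'" "lact x (scaleM c m) = scaleM c (lact x m)"
  "lact (x + y) m = lact x m + lact y m" "lact (scaleL c x) m = scaleM c (lact x m)"
  using linear_lact_module[of x] linear_lact_algebra[of m]
  unfolding Vector_Spaces.linear_iff by auto

lemma ract_simps:
  "ract (m + m') x = ract m x + ract m' x" "ract (scaleM c m) x = scaleM c (ract m x)"
  "ract m (x + y) = ract m x + ract m y" "ract m (scaleL c x) = scaleM c (ract m x)"
  using linear_ract_module[of x] linear_ract_algebra[of m]
  unfolding Vector_Spaces.linear_iff by auto

lemma lmul_0 [simp]: "lmul x 0 = 0"
  using lmul_simps(1)[of x 0 0] by simp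

lemma lact_0 [simp]: "lact x 0 = 0" "lact 0 m = 0"
  using lact_simps(1)[of x 0 0] lact_simps(3)[of 0 0 m] by auto

lemma ract_0 [simp]: "ract 0 x = 0" "ract m 0 = 0"
  using ract_simps(1)[of 0 0 x] ract_simps(3)[of m 0 0] by auto

lemma lact_minus [simp]: "lact x (- m) = - lact x m"
  using lact_simps(1)[of x m "-m"] by (simp add: eq_neg_iff_add_eq_0 add.commute)

lemma ract_minus [simp]: "ract (- m) x = - ract m x"
  using ract_simps(1)[of m "-m" x] by (simp add: eq_neg_iff_add_eq_0 add.commute)

lemma lact_diff [simp]: "lact x (m - m') = lact x m - lact x m'"
  using lact_simps(1)[of x m "- m'"] by simp

lemma ract_diff [simp]: "ract (m - m') x = ract m x - ract m' x"
  using ract_simps(1)[of m "- m'" x] by simp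

lemma cochain_length: "f \<in> C n N \<Longrightarrow> length xs \<noteq> n \<Longrightarrow> f xs = 0"
  by (simp add: cochains_def)

lemma cochain_mem: "f \<in> C n N \<Longrightarrow> length xs = n \<Longrightarrow> f xs \<in> N"
  by (simp add: cochains_def)

lemma cochain_mono: "f \<in> C n N \<Longrightarrow> N \<subseteq> N' \<Longrightarrow> f \<in> C n N'"
  by (auto simp: cochains_def)

lemma cochain_0_iff: "f \<in> C 0 N \<longleftrightarrow> f [] \<in> N \<and> (\<forall>xs. xs \<noteq> [] \<longrightarrow> f xs = 0)"
  by (auto simp: cochains_def)

text \<open>Currying: an (n+1)-linear map is a linear map into the n-linear maps. The inductions on
  the degree rest on this form. Linearity can be stated for tails of every length because cochains
  vanish on lists of the wrong length.\<close>

lemma cochain_Suc_iff: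
  "f \<in> C (Suc n) N \<longleftrightarrow> f [] = 0 \<and> (\<forall>x. (\<lambda>ys. f (x # ys)) \<in> C n N)
     \<and> (\<forall>ys. Vector_Spaces.linear scaleL scaleM (\<lambda>x. f (x # ys)))"
proof (intro iffI conjI allI)
  assume f: "f \<in> C (Suc n) N"
  show "f [] = 0" using f by (simp add: cochains_def)
  show "(\<lambda>ys. f (x # ys)) \<in> C n N" for x
  proof -
    have "Vector_Spaces.linear scaleL scaleM (\<lambda>y. f (x # xs[i := y]))"
      if "length xs = n" "i < n" for xs i
    proof -
      have "Vector_Spaces.linear scaleL scaleM (\<lambda>y. f ((x # xs)[Suc i := y]))"
        using f that unfolding cochains_def by (simp del: list_update.simps)
      then show ?thesis by simp
    qed
    then show ?thesis using f by (simp add: cochains_def)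
  qed
  show "Vector_Spaces.linear scaleL scaleM (\<lambda>x. f (x # ys))" for ys
  proof (cases "length ys = n")
    case True
    \<comment> \<open>The head \<open>0\<close> is a placeholder that the update at slot
      \<open>0\<close> overwrites.\<close>
    have "Vector_Spaces.linear scaleL scaleM (\<lambda>y. f ((0 # ys)[0 := y]))"
      using f True unfolding cochains_def by (simp del: list_update.simps)
    then show ?thesis by simp
  next
    case False
    then have "f (x # ys) = 0" for x using cochain_length[OF f] by simp
    then show ?thesis by (simp add: linear_iff_LM)
  qed
next
  assume R: "f [] = 0 \<and> (\<forall>x. (\<lambda>ys. f (x # ys)) \<in> C n N)
     \<and> (\<forall>ys. Vector_Spaces.linear scaleL scaleM (\<lambda>x. f (x # ys)))"
  show "f \<in> C (Suc n) N"
    unfolding cochains_def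
  proof (intro CollectI conjI allI impI)
    fix xs
    show "length xs = Suc n \<Longrightarrow> f xs \<in> N" "length xs \<noteq> Suc n \<Longrightarrow> f xs = 0"
      using R by (cases xs; force simp: cochains_def)+
    fix i assume xs: "length xs = Suc n" and i: "i < Suc n"
    then obtain x ys where xy: "xs = x # ys" "length ys = n" by (cases xs) auto
    show "Vector_Spaces.linear scaleL scaleM (\<lambda>x. f (xs[i := x]))"
    proof (cases i)
      case 0
      then show ?thesis using R xy by simp
    next
      case (Suc j)
      then show ?thesis using R xy i by (auto simp: cochains_def)
    qed
  qed
qed

lemma cochain_tail: "f \<in> C (Suc n) N \<Longrightarrow> (\<lambda>ys. f (x # ys)) \<in> C n N"
  by (simp add: cochain_Suc_iff)

lemma cochain_Nil: "f \<in> C (Suc n) N \<Longrightarrow> f [] = 0"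
  by (simp add: cochain_Suc_iff)

lemma cochain_head:
  assumes "f \<in> C (Suc n) N"
  shows "f ((x + y) # ys) = f (x # ys) + f (y # ys)"
    "f (scaleL c x # ys) = scaleM c (f (x # ys))"
  using assms by (auto simp: cochain_Suc_iff linear_iff_LM)

lemma cochain_zero: "0 \<in> N \<Longrightarrow> (\<lambda>xs. 0) \<in> C n N"
  by (simp add: cochains_def linear_iff_LM)

lemma cochain_add:
  "M.subspace N \<Longrightarrow> f \<in> C n N \<Longrightarrow> g \<in> C n N \<Longrightarrow> (\<lambda>xs. f xs + g xs) \<in> C n N"
  by (simp add: cochains_def linear_iff_LM M.subspace_add M.scale_right_distrib)

lemma cochain_scale:
  "M.subspace N \<Longrightarrow> f \<in> C n N \<Longrightarrow> (\<lambda>xs. scaleM c (f xs)) \<in> C n N"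
  by (simp add: cochains_def linear_iff_LM M.subspace_scale M.scale_right_distrib mult.commute)

lemma cochain_minus:
  "M.subspace N \<Longrightarrow> f \<in> C n N \<Longrightarrow> (\<lambda>xs. - f xs) \<in> C n N"
  using cochain_scale[of N f n "-1"] by simp

lemma cochain_diff:
  "M.subspace N \<Longrightarrow> f \<in> C n N \<Longrightarrow> g \<in> C n N \<Longrightarrow> (\<lambda>xs. f xs - g xs) \<in> C n N"
  using cochain_add[of N f n "\<lambda>xs. - g xs"] cochain_minus[of N g n] by simp

lemma cochain_map:
  assumes f: "f \<in> C n N"
    and h: "\<And>a b. h (a + b) = h a + h b" "\<And>c a. h (scaleM c a) = scaleM c (h a)"
    and N: "\<And>a. a \<in> N \<Longrightarrow> h a \<in> N'"
  shows "(\<lambda>xs. h (f xs)) \<in> C n N'"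
proof -
  have "h 0 = 0" using h(1)[of 0 0] by simp
  then show ?thesis using f h N by (auto simp: cochains_def linear_iff_LM)
qed

lemma cochain_slot_sum:
  assumes N: "M.subspace N"
    and T: "Vector_Spaces.linear scaleL scaleL T"
  shows "f \<in> C n N \<Longrightarrow> slot_sum T f \<in> C n N"
proof (induction n arbitrary: f)
  case 0
  have "slot_sum T f xs = 0" for xs
  proof (cases xs)
    case (Cons x ys)
    have "slot_sum T (\<lambda>zs. f (x # zs)) ys = slot_sum T (\<lambda>zs. 0) ys"
      by (rule slot_sum_cong) (use 0 in \<open>simp add: cochain_0_iff\<close>)
    then show ?thesis using 0 Cons by (simp add: cochain_0_iff slot_sum_zero)
  qed simp
  then show ?case using M.subspace_0[OF N] by (simp add: cochain_0_iff)
next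
  case (Suc n)
  have T': "T (x + y) = T x + T y" "T (scaleL c x) = scaleL c (T x)" for x y c
    using T by (auto simp: Vector_Spaces.linear_iff)
  note hd = cochain_head[OF Suc.prems]
  show ?case
    unfolding cochain_Suc_iff
  proof (intro conjI allI)
    show "(\<lambda>ys. slot_sum T f (x # ys)) \<in> C n N" for x
      unfolding slot_sum.simps
      by (intro cochain_add N cochain_tail[OF Suc.prems] Suc.IH)
    fix ys
    have "slot_sum T (\<lambda>zs. scaleM c (f (x # zs))) ys = scaleM c (slot_sum T (\<lambda>zs. f (x # zs)) ys)"
      for c x by (rule slot_sum_linear) (simp_all add: M.scale_right_distrib)
    then show "Vector_Spaces.linear scaleL scaleM (\<lambda>x. slot_sum T f (x # ys))"
      unfolding linear_iff_LM slot_sum.simps T' hd slot_sum_add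
      by (simp add: M.scale_right_distrib)
  qed simp
qed

text \<open>Additivity in the operator, unlike additivity in \<open>f\<close>, rests on
  multilinearity, which splits \<open>f ((S x + T x) # xs)\<close>.\<close>

lemma slot_sum_operator_add:
  assumes "f \<in> C n N"
  shows "slot_sum (\<lambda>y. S y + T y) f xs = slot_sum S f xs + slot_sum T f xs"
  using assms
proof (induction xs arbitrary: n f)
  case (Cons x xs)
  show ?case
  proof (cases n)
    case 0
    have "slot_sum U f (x # xs) = 0" for U
      using slot_sum_cong[of xs "\<lambda>ys. f (x # ys)" "\<lambda>ys. 0" U] Cons.prems 0
      by (simp add: cochain_0_iff slot_sum_zero)
    then show ?thesis by (simp only: add_0)
  next
    case (Suc k)
    have f: "f \<in> C (Suc k) N" using Cons.prems Suc by simp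
    show ?thesis
      using Cons.IH[OF cochain_tail[OF f]] by (simp add: cochain_head[OF f])
  qed
qed simp

lemma slot_sum_operator_scale:
  assumes "f \<in> C n N"
  shows "slot_sum (\<lambda>y. scaleL c (T y)) f xs = scaleM c (slot_sum T f xs)"
  using assms
proof (induction xs arbitrary: n f)
  case (Cons x xs)
  show ?case
  proof (cases n)
    case 0
    have "slot_sum U f (x # xs) = 0" for U
      using slot_sum_cong[of xs "\<lambda>ys. f (x # ys)" "\<lambda>ys. 0" U] Cons.prems 0
      by (simp add: cochain_0_iff slot_sum_zero)
    then show ?thesis by (simp only: M.scale_zero_right)
  next
    case (Suc k)
    have f: "f \<in> C (Suc k) N" using Cons.prems Suc by simp
    show ?thesis
      using Cons.IH[OF cochain_tail[OF f]]
      by (simp add: cochain_head[OF f] M.scale_right_distrib)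
  qed
qed simp

text \<open>The terms where the two operators hit different slots agree on both sides.\<close>

lemma slot_sum_commutator:
  assumes "f \<in> C n N"
  shows "slot_sum S (slot_sum T f) xs + slot_sum (\<lambda>y. S (T y)) f xs
       = slot_sum T (slot_sum S f) xs + slot_sum (\<lambda>y. T (S y)) f xs"
  using assms
proof (induction xs arbitrary: n f)
  case (Cons x xs)
  show ?case
  proof (cases n)
    case 0
    have z: "g = (\<lambda>ys. 0) \<Longrightarrow> slot_sum U g ys = 0" for U g ys
      by (simp add: slot_sum_zero)
    have "(\<lambda>ys. f (y # ys)) = (\<lambda>ys. 0)" for y
      using Cons.prems 0 by (simp add: cochain_0_iff)
    then show ?thesis using Cons.prems 0 by (simp add: z slot_sum_add)
  next
    case (Suc k)
    have f: "f \<in> C (Suc k) N" using Cons.prems Suc by simp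
    have "slot_sum S (\<lambda>ys. slot_sum T f (x # ys)) xs
      = slot_sum S (\<lambda>ys. f (T x # ys)) xs + slot_sum S (slot_sum T (\<lambda>ys. f (x # ys))) xs"
      "slot_sum T (\<lambda>ys. slot_sum S f (x # ys)) xs
      = slot_sum T (\<lambda>ys. f (S x # ys)) xs + slot_sum T (slot_sum S (\<lambda>ys. f (x # ys))) xs"
      by (simp_all add: slot_sum_add)
    then show ?thesis
      using Cons.IH[OF cochain_tail[OF f], of x] by (simp add: algebra_simps)
  qed
qed simp

section \<open>Cartan calculus: the induced action and the differential\<close>

definition lie :: "'l \<Rightarrow> ('l list \<Rightarrow> 'm) \<Rightarrow> 'l list \<Rightarrow> 'm" where
  "lie x f xs = lact x (f xs) - slot_sum (lmul x) f xs"

text \<open>The differential, defined by recursion so that Cartan's formula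
  \<open>\<iota>\<^sub>x \<circ> d + d \<circ> \<iota>\<^sub>x = lie x\<close> holds by construction in positive degrees;
  here \<open>\<iota>\<^sub>x f ys = f (x # ys)\<close>.\<close>

primrec diff :: "('l list \<Rightarrow> 'm) \<Rightarrow> 'l list \<Rightarrow> 'm" where
  "diff f [] = 0"
| "diff f (x # xs) =
     (if xs = [] then - ract (f []) x else lie x f xs - diff (\<lambda>ys. f (x # ys)) xs)"

definition subbimodule :: "'m set \<Rightarrow> bool" where
  "subbimodule N \<longleftrightarrow> M.subspace N \<and> (\<forall>x. \<forall>m\<in>N. lact x m \<in> N \<and> ract m x \<in> N)"

lemma subbimoduleD:
  assumes "subbimodule N"
  shows "M.subspace N" "m \<in> N \<Longrightarrow> lact x m \<in> N" "m \<in> N \<Longrightarrow> ract m x \<in> N"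
  using assms by (auto simp: subbimodule_def)

lemma subbimodule_UNIV: "subbimodule UNIV"
  by (simp add: subbimodule_def)

lemma lie_Nil: "lie x f [] = lact x (f [])"
  by (simp add: lie_def)

text \<open>The commutator of \<open>lie x\<close> with contraction by \<open>y\<close> is
  contraction by \<open>lmul x y\<close>: this is the slot-sum term of the head.\<close>

lemma lie_Cons: "lie x f (y # ys) = lie x (\<lambda>zs. f (y # zs)) ys - f (lmul x y # ys)"
  by (simp add: lie_def)

lemma lie_add: "lie x (\<lambda>ys. f ys + g ys) xs = lie x f xs + lie x g xs"
  by (simp add: lie_def slot_sum_add lact_simps)

lemma lie_diff: "lie x (\<lambda>ys. f ys - g ys) xs = lie x f xs - lie x g xs"
  by (simp add: lie_def slot_sum_diff)

lemma lie_scale: "lie x (\<lambda>ys. scaleM c (f ys)) xs = scaleM c (lie x f xs)"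
proof -
  have "slot_sum (lmul x) (\<lambda>ys. scaleM c (f ys)) xs = scaleM c (slot_sum (lmul x) f xs)"
    by (rule slot_sum_linear) (simp_all add: M.scale_right_distrib)
  then show ?thesis by (simp add: lie_def lact_simps M.scale_right_diff_distrib)
qed

lemma lie_cong:
  "(\<And>ys. length ys = length xs \<Longrightarrow> f ys = g ys) \<Longrightarrow> lie x f xs = lie x g xs"
  unfolding lie_def by (simp add: slot_sum_cong[of xs f g])

lemma cochain_lie:
  assumes N: "subbimodule N" and f: "f \<in> C n N"
  shows "lie x f \<in> C n N"
proof -
  have "(\<lambda>xs. lact x (f xs) - slot_sum (lmul x) f xs) \<in> C n N"
    using subbimoduleD[OF N] L.linear_lmul_right
    by (intro cochain_diff cochain_map[OF f] cochain_slot_sum f) (auto simp: lact_simps)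
  then show ?thesis by (simp add: lie_def[abs_def])
qed

lemma linear_lie:
  assumes f: "f \<in> C n N"
  shows "lie (x + y) f xs = lie x f xs + lie y f xs"
    "lie (scaleL c x) f xs = scaleM c (lie x f xs)"
proof -
  have "lmul (x + y) = (\<lambda>z. lmul x z + lmul y z)" "lmul (scaleL c x) = (\<lambda>z. scaleL c (lmul x z))"
    by (simp_all add: fun_eq_iff lmul_simps)
  then show "lie (x + y) f xs = lie x f xs + lie y f xs"
    "lie (scaleL c x) f xs = scaleM c (lie x f xs)"
    by (simp_all add: lie_def lact_simps slot_sum_operator_add[OF f] slot_sum_operator_scale[OF f]
        M.scale_right_diff_distrib)
qed

text \<open>\<open>LLM\<close> handles the values. On the arguments the Leibniz identity turns
  \<open>slot_sum (lmul (lmul x y))\<close> into a commutator, in reversed order because operators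
  on arguments compose contravariantly; the minus sign in \<open>lie\<close> restores the
  order.\<close>

lemma lie_lmul:
  assumes f: "f \<in> C n N"
  shows "lie (lmul x y) f xs = lie x (lie y f) xs - lie y (lie x f) xs"
proof -
  \<comment> \<open>Acting on values commutes with summing over slots, so the mixed terms cancel in
    the commutator.\<close>
  have *: "slot_sum (lmul z) (lie w f) xs
      = lact w (slot_sum (lmul z) f xs) - slot_sum (lmul z) (slot_sum (lmul w) f) xs" for z w
  proof -
    have "slot_sum (lmul z) (\<lambda>ys. lact w (f ys)) xs = lact w (slot_sum (lmul z) f xs)"
      by (rule slot_sum_linear) (simp_all add: lact_simps)
    then show ?thesis unfolding lie_def[abs_def] slot_sum_diff by simp
  qed
  have "(\<lambda>z. lmul x (lmul y z)) = (\<lambda>z. lmul (lmul x y) z + lmul y (lmul x z))"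
    by (intro ext L.leibniz)
  then have "slot_sum (\<lambda>z. lmul x (lmul y z)) f xs
      = slot_sum (lmul (lmul x y)) f xs + slot_sum (\<lambda>z. lmul y (lmul x z)) f xs"
    using slot_sum_operator_add[OF f, of "lmul (lmul x y)" "\<lambda>z. lmul y (lmul x z)" xs] by simp
  then have "slot_sum (lmul (lmul x y)) f xs
      = slot_sum (lmul y) (slot_sum (lmul x) f) xs - slot_sum (lmul x) (slot_sum (lmul y) f) xs"
    using slot_sum_commutator[OF f, of "lmul x" "lmul y" xs] by (simp add: algebra_simps)
  then show ?thesis
    unfolding lie_def[of "lmul x y"] lie_def[of x "lie y f"] lie_def[of y "lie x f"] *
    by (simp add: lie_def LLM algebra_simps)
qed

lemma diff_add: "diff (\<lambda>ys. f ys + g ys) xs = diff f xs + diff g xs"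
proof (induction xs arbitrary: f g)
  case (Cons x xs)
  show ?case
    using Cons.IH[of "\<lambda>ys. f (x # ys)" "\<lambda>ys. g (x # ys)"]
    by (simp add: lie_add ract_simps)
qed simp

lemma diff_minus: "diff (\<lambda>ys. f ys - g ys) xs = diff f xs - diff g xs"
proof (induction xs arbitrary: f g)
  case (Cons x xs)
  show ?case
    using Cons.IH[of "\<lambda>ys. f (x # ys)" "\<lambda>ys. g (x # ys)"]
    by (simp add: lie_diff)
qed simp

lemma diff_scale: "diff (\<lambda>ys. scaleM c (f ys)) xs = scaleM c (diff f xs)"
proof (induction xs arbitrary: f)
  case (Cons x xs)
  show ?case
    using Cons.IH[of "\<lambda>ys. f (x # ys)"]
    by (simp add: lie_scale ract_simps M.scale_right_diff_distrib)
qed simp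

lemma diff_cong:
  "(\<And>ys. Suc (length ys) = length xs \<Longrightarrow> f ys = g ys) \<Longrightarrow> diff f xs = diff g xs"
proof (induction xs arbitrary: f g)
  case (Cons x xs)
  have "diff (\<lambda>ys. f (x # ys)) xs = diff (\<lambda>ys. g (x # ys)) xs"
    by (rule Cons.IH) (simp add: Cons.prems)
  moreover have "lie x f xs = lie x g xs"
    by (rule lie_cong) (simp add: Cons.prems)
  moreover have "xs = [] \<Longrightarrow> f [] = g []" by (simp add: Cons.prems)
  ultimately show ?case by simp
qed simp

text \<open>In positive degree \<open>f [] = 0\<close>, so the two branches of \<open>diff\<close>
  agree on one-element lists; the right action enters only once contraction has reached degree
  zero.\<close>

lemma diff_Cons:
  assumes "f \<in> C (Suc n) N"
  shows "diff f (x # xs) = lie x f xs - diff (\<lambda>ys. f (x # ys)) xs"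
  using cochain_Nil[OF assms] by (simp add: lie_Nil)

lemma diff_cochain:
  assumes N: "subbimodule N"
  shows "f \<in> C n N \<Longrightarrow> diff f \<in> C (Suc n) N"
proof (induction n arbitrary: f)
  case 0
  \<comment> \<open>Lists as long as \<open>ys\<close> are nonempty, and there a degree-zero cochain
    vanishes, so \<open>f\<close> may be replaced by the zero map.\<close>
  have z: "diff f (x # ys) = 0" if "ys \<noteq> []" for x ys
  proof -
    have "f zs = 0" if "length zs = length ys" for zs
      using 0 that \<open>ys \<noteq> []\<close> by (cases zs; cases ys) (auto simp: cochain_0_iff)
    then have "diff f (x # ys) = diff (\<lambda>ys. 0) (x # ys)"
      by (intro diff_cong) simp
    also have "\<dots> = 0" using diff_scale[of 0 "\<lambda>ys. 0" "x # ys"] by simp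
    finally show ?thesis .
  qed
  have "f [] \<in> N" using 0 by (simp add: cochain_0_iff)
  then have "- ract (f []) x \<in> N" for x
    using subbimoduleD[OF N] M.subspace_neg by blast
  moreover have "Vector_Spaces.linear scaleL scaleM (\<lambda>x. diff f (x # ys))" for ys
  proof (cases "ys = []")
    case False
    show ?thesis unfolding linear_iff_LM z[OF False] by simp
  qed (simp add: linear_iff_LM ract_simps)
  ultimately show ?case
    unfolding cochain_Suc_iff cochain_0_iff using z by simp
next
  case (Suc n)
  note t = cochain_tail[OF Suc.prems]
  show ?case
    unfolding cochain_Suc_iff[of _ "Suc n"] diff_Cons[OF Suc.prems]
  proof (intro conjI allI)
    show "(\<lambda>ys. lie x f ys - diff (\<lambda>ys. f (x # ys)) ys) \<in> C (Suc n) N" for x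
      by (intro cochain_diff cochain_lie Suc.IH t N Suc.prems subbimoduleD)
    show "Vector_Spaces.linear scaleL scaleM (\<lambda>x. lie x f ys - diff (\<lambda>ys. f (x # ys)) ys)" for ys
      unfolding linear_iff_LM cochain_head[OF Suc.prems] linear_lie[OF Suc.prems] diff_add diff_scale
      by (simp add: M.scale_right_diff_distrib)
  qed simp
qed

text \<open>Contracting both sides with \<open>y\<close> and using the claim one degree lower leaves
  exactly \<open>lie_lmul\<close>. In degree zero the claim is the axiom \<open>LML\<close>.\<close>

lemma diff_lie:
  "f \<in> C n UNIV \<Longrightarrow> diff (lie x f) xs = lie x (diff f) xs"
proof (induction n arbitrary: f xs)
  case 0
  have c: "diff (lie x f) \<in> C (Suc 0) UNIV" "lie x (diff f) \<in> C (Suc 0) UNIV"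
    by (intro diff_cochain cochain_lie subbimodule_UNIV 0)+
  show ?case
  proof (cases "length xs = Suc 0")
    case True
    then obtain y where "xs = [y]" by (auto simp: length_Suc_conv)
    then show ?thesis by (simp add: lie_def LML)
  next
    case False
    then show ?thesis using c[THEN cochain_length] by simp
  qed
next
  case (Suc n)
  note f = Suc.prems
  note t = cochain_tail[OF f]
  have lf: "lie x f \<in> C (Suc n) UNIV" by (intro cochain_lie subbimodule_UNIV f)
  show ?case
  proof (cases xs)
    case Nil
    then show ?thesis by (simp add: lie_Nil)
  next
    case (Cons y ys)
    have "diff (lie x f) (y # ys) = lie y (lie x f) ys - diff (\<lambda>zs. lie x f (y # zs)) ys"
      by (rule diff_Cons[OF lf])
    also have "\<dots> = lie y (lie x f) ys - lie x (diff (\<lambda>zs. f (y # zs))) ys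
        + diff (\<lambda>zs. f (lmul x y # zs)) ys"
      unfolding lie_Cons diff_minus Suc.IH[OF t] by simp
    finally have 1: "diff (lie x f) (y # ys) = \<dots>" .
    have "lie x (diff f) (y # ys) = lie x (\<lambda>zs. diff f (y # zs)) ys - diff f (lmul x y # ys)"
      by (rule lie_Cons)
    also have "\<dots> = lie x (lie y f) ys - lie x (diff (\<lambda>zs. f (y # zs))) ys
        - (lie (lmul x y) f ys - diff (\<lambda>zs. f (lmul x y # zs)) ys)"
      unfolding diff_Cons[OF f] lie_diff by simp
    finally have 2: "lie x (diff f) (y # ys) = \<dots>" .
    show ?thesis unfolding Cons 1 2 lie_lmul[OF f] by simp
  qed
qed

text \<open>Contracting with \<open>y\<close> and using Cartan's formula twice leaves the commutator
  of \<open>lie y\<close> and \<open>diff\<close>, which is zero, and the same claim for the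
  contracted cochain. The base case is the axiom \<open>MLL\<close>.\<close>

lemma diff_diff: "f \<in> C n UNIV \<Longrightarrow> diff (diff f) xs = 0"
proof (induction n arbitrary: f xs)
  case 0
  have c: "diff (diff f) \<in> C (Suc (Suc 0)) UNIV"
    by (intro diff_cochain subbimodule_UNIV 0)
  show ?case
  proof (cases "length xs = Suc (Suc 0)")
    case True
    then obtain x y where "xs = [x, y]" by (auto simp: length_Suc_conv)
    then show ?thesis by (simp add: lie_def MLL)
  next
    case False
    then show ?thesis using c[THEN cochain_length] by simp
  qed
next
  case (Suc n)
  note f = Suc.prems
  have df: "diff f \<in> C (Suc (Suc n)) UNIV" by (intro diff_cochain subbimodule_UNIV f)
  show ?case
  proof (cases xs)
    case (Cons y ys)
    have "diff (diff f) (y # ys) = lie y (diff f) ys - diff (\<lambda>zs. diff f (y # zs)) ys"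
      by (rule diff_Cons[OF df])
    also have "\<dots> = 0"
      unfolding diff_Cons[OF f] diff_minus diff_lie[OF f] Suc.IH[OF cochain_tail[OF f]] by simp
    finally show ?thesis using Cons by simp
  qed simp
qed

section \<open>Agreement with the explicit differential\<close>

text \<open>The terms in which \<open>x\<close> acts from the left or multiplies another argument
  make up \<open>lie x f xs\<close>. In all others the indices drop by one, which changes the
  sign.\<close>

lemma leibniz_d_Suc_Cons:
  assumes xs: "length xs = Suc n"
  shows "leibniz_d lmul scaleM lact ract (Suc n) f (x # xs)
    = lie x f xs - leibniz_d lmul scaleM lact ract n (\<lambda>ys. f (x # ys)) xs"
proof -
  have o: "omit 0 (x # zs) = zs" "omit (Suc i) (x # zs) = x # omit i zs" for i and zs :: "'l list"
    by (simp_all add: omit_def)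
  show ?thesis
    unfolding leibniz_d_def lie_def slot_sum_eq_sum sum.lessThan_Suc_shift[of _ "Suc n"]
      sum.lessThan_Suc_shift[of "\<lambda>j. scaleM ((-1) ^ j) (lact ((x # xs) ! j) (f (omit j (x # xs))))" n]
    using xs
    by (simp add: o sum.lessThan_Suc_shift[of _ i for i] sum.distrib sum_subtractf sum_negf algebra_simps
        del: sum.lessThan_Suc)
qed

text \<open>On lists of length n + 1 both sides obey the same recursion; on other lists
  \<open>leibniz_d\<close> is 0 by definition and \<open>diff f\<close> is 0 because it is a
  cochain.\<close>

lemma leibniz_d_eq_diff:
  assumes "f \<in> C n N"
  shows "leibniz_d lmul scaleM lact ract n f = diff f"
proof
  fix xs
  have eq: "length xs = Suc n \<Longrightarrow> leibniz_d lmul scaleM lact ract n g xs = diff g xs" for g n xs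
  proof (induction n arbitrary: g xs)
    case 0
    then obtain x where "xs = [x]" by (auto simp: length_Suc_conv)
    then show ?case by (simp add: leibniz_d_def)
  next
    case (Suc n)
    then obtain x ys where xs: "xs = x # ys" "length ys = Suc n" by (cases xs) auto
    then have "ys \<noteq> []" by auto
    then show ?case
      unfolding xs(1) leibniz_d_Suc_Cons[OF xs(2)] Suc.IH[OF xs(2)] by simp
  qed
  have "diff f \<in> C (Suc n) UNIV"
    by (intro diff_cochain subbimodule_UNIV cochain_mono[OF assms]) simp
  then show "leibniz_d lmul scaleM lact ract n f xs = diff f xs"
    using eq[of xs n f] cochain_length[of "diff f" "Suc n" UNIV xs]
    by (cases "length xs = Suc n") (auto simp: leibniz_d_def)
qed

end

section \<open>Linear algebra modulo a subspace\<close>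

context Vector_Spaces.vector_space
begin

lemma linear_simps:
  assumes "Vector_Spaces.linear scale scale T"
  shows "T (x + y) = T x + T y" "T (scale c x) = scale c (T x)" "T 0 = 0"
    "T (- x) = - T x" "T (x - y) = T x - T y"
proof -
  show a: "T (x + y) = T x + T y" and s: "T (scale c x) = scale c (T x)" for x y c
    using assms by (auto simp: Vector_Spaces.linear_iff)
  show "T 0 = 0" using s[of 0 0] by simp
  show m: "T (- x) = - T x" for x using s[of "-1" x] by simp
  show "T (x - y) = T x - T y" using a[of x "- y"] m[of y] by simp
qed

lemma linear_scale_iff:
  "Vector_Spaces.linear scale scale T \<longleftrightarrow>
     (\<forall>x y. T (x + y) = T x + T y) \<and> (\<forall>c x. T (scale c x) = scale c (T x))"
  unfolding Vector_Spaces.linear_iff using vector_space_axioms by simp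

lemma linear_funpow:
  "Vector_Spaces.linear scale scale T \<Longrightarrow> Vector_Spaces.linear scale scale (T ^^ k)"
  by (induction k) (simp_all add: linear_scale_iff)

lemma subspace_linear_image:
  assumes T: "Vector_Spaces.linear scale scale T" and W: "subspace W"
  shows "subspace (T ` W)"
proof (rule subspaceI)
  show "0 \<in> T ` W"
    using linear_simps(3)[OF T] subspace_0[OF W] by (metis image_eqI)
  show "x + y \<in> T ` W" if "x \<in> T ` W" "y \<in> T ` W" for x y
    using that subspace_add[OF W] linear_simps(1)[OF T, symmetric] by (auto intro!: imageI)
  show "scale c x \<in> T ` W" if "x \<in> T ` W" for c x
    using that subspace_scale[OF W] linear_simps(2)[OF T, symmetric] by (auto intro!: imageI)
qed

lemma span_linear_image:
  assumes T: "Vector_Spaces.linear scale scale T"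
  shows "span (T ` A) = T ` span A"
proof (rule span_subspace)
  show "T ` A \<subseteq> T ` span A" using span_superset by blast
  show "subspace (T ` span A)" by (intro subspace_linear_image T subspace_span)
  show "T ` span A \<subseteq> span (T ` A)"
  proof safe
    fix x assume "x \<in> span A"
    then show "T x \<in> span (T ` A)"
      by (induction rule: span_induct_alt)
        (auto simp: linear_simps[OF T] intro: span_add span_scale span_base span_zero)
  qed
qed

text \<open>Extend a basis of \<open>W\<close> to the whole space and kill the part in
  \<open>W\<close>. The kernel of \<open>p\<close> is exactly \<open>W\<close>, so the image of
  \<open>p\<close> stands in for the quotient.\<close>

lemma projection_along_subspace:
  assumes W: "subspace W"
  obtains p where "Vector_Spaces.linear scale scale p" "\<And>x. x \<in> W \<Longrightarrow> p x = 0"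
    "\<And>x. x - p x \<in> W"
proof -
  interpret p: vector_space_pair scale scale by unfold_locales
  obtain B where B: "B \<subseteq> W" "independent B" "W \<subseteq> span B"
    using maximal_independent_subset by blast
  obtain B' where B': "B \<subseteq> B'" "independent B'" "UNIV \<subseteq> span B'"
    using maximal_independent_subset_extend[of B UNIV] B(2) by auto
  obtain p where p: "Vector_Spaces.linear scale scale p" "\<forall>x\<in>B'. p x = (if x \<in> B then 0 else x)"
    using p.linear_independent_extend[OF B'(2), of "\<lambda>x. if x \<in> B then 0 else x"] by blast
  note l = linear_simps[OF p(1)]
  have 1: "p x = 0" if "x \<in> W" for x
  proof -
    have "x \<in> span B" using that B by blast
    then show ?thesis
      by (induction rule: span_induct_alt) (use B'(1) p(2) in \<open>auto simp: l\<close>)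
  qed
  have 2: "x - p x \<in> W" for x
  proof -
    have "x \<in> span B'" using B' by blast
    then show ?thesis
    proof (induction rule: span_induct_alt)
      case base
      then show ?case using subspace_0[OF W] by (simp add: l)
    next
      case (step c x y)
      have "x - p x \<in> W" using step(1) p(2) B(1) subspace_0[OF W] by auto
      then have "scale c (x - p x) + (y - p y) \<in> W"
        using step(2) W by (intro subspace_add subspace_scale)
      then show ?case by (simp add: l scale_right_diff_distrib algebra_simps)
    qed
  qed
  show thesis by (rule that[OF p(1) 1 2])
qed

text \<open>This turns finite codimension of \<open>W\<close> into finite dimension of the image of
  \<open>p\<close>.\<close>

lemma span_Un_kernel:
  assumes p: "Vector_Spaces.linear scale scale p" "\<And>x. x \<in> W \<Longrightarrow> p x = 0"
    and x: "x \<in> span (F \<union> W)"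
  shows "p x \<in> span (p ` F)"
  using x
proof (induction rule: span_induct_alt)
  case (step c x y)
  have "p x \<in> span (p ` F)" using step(1) p(2) by (auto intro: span_base simp: span_zero)
  then show ?case using step(2) by (simp add: linear_simps[OF p(1)] span_add span_scale)
qed (simp add: linear_simps[OF p(1)] span_zero)

text \<open>Otherwise each vector lies outside the span of its successors, and adding vectors from
  index \<open>card F\<close> down to 0 builds \<open>card F + 1\<close> independent vectors inside
  \<open>span F\<close>.\<close>

lemma infinite_sequence_dependent:
  fixes v :: "nat \<Rightarrow> 'b"
  assumes F: "finite F" and v: "range v \<subseteq> span F"
  shows "\<exists>j. v j \<in> span (v ` {j<..})"
proof (rule ccontr)
  assume "\<not> ?thesis"
  then have n: "v j \<notin> span (v ` {j<..})" for j by blast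
  define k where "k = Suc (card F)"
  have "independent (v ` {k - i..<k}) \<and> card (v ` {k - i..<k}) = i" if "i \<le> k" for i
    using that
  proof (induction i)
    case (Suc i)
    have e: "{k - Suc i..<k} = insert (k - Suc i) {k - i..<k}"
      using Suc.prems by auto
    have "v ` {k - i..<k} \<subseteq> v ` {k - Suc i<..}"
      using Suc.prems by (intro image_mono) auto
    then have "v (k - Suc i) \<notin> span (v ` {k - i..<k})"
      using n span_mono by blast
    moreover from this have "v (k - Suc i) \<notin> v ` {k - i..<k}" using span_base by blast
    ultimately show ?case using Suc unfolding e by (simp add: independent_insert)
  qed (simp add: independent_empty)
  from this[of k] have "independent (v ` {0..<k})" "card (v ` {0..<k}) = k" by auto
  moreover have "v ` {0..<k} \<subseteq> span F" using v by blast
  ultimately have "k \<le> card F" using independent_span_bound[OF F] by metis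
  then show False by (simp add: k_def)
qed

text \<open>The iterates of \<open>m\<close> are dependent modulo \<open>W\<close>, so some
  \<open>(T ^^ j) m\<close> is congruent to a combination of later iterates, that is, to
  \<open>(T ^^ j) (T u)\<close> with \<open>u\<close> in \<open>N\<close>. Injectivity modulo
  \<open>W\<close> cancels \<open>T ^^ j\<close>.\<close>

lemma surjective_mod_subspace:
  assumes T: "Vector_Spaces.linear scale scale T"
    and N: "subspace N" and W: "subspace W"
    and TN: "\<And>x. x \<in> N \<Longrightarrow> T x \<in> N"
    and inj: "\<And>x. x \<in> N \<Longrightarrow> T x \<in> W \<Longrightarrow> x \<in> W"
    and F: "finite F" "N \<subseteq> span (F \<union> W)"
    and m: "m \<in> N"
  shows "\<exists>m'\<in>N. T m' - m \<in> W"
proof -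
  obtain p where p: "Vector_Spaces.linear scale scale p" "\<And>x. x \<in> W \<Longrightarrow> p x = 0"
    "\<And>x. x - p x \<in> W"
    by (rule projection_along_subspace[OF W]) blast
  have TkN: "x \<in> N \<Longrightarrow> (T ^^ k) x \<in> N" for x k
    by (induction k) (auto intro: TN)
  have Tk_inj: "x \<in> N \<Longrightarrow> (T ^^ k) x \<in> W \<Longrightarrow> x \<in> W" for x k
    by (induction k) (auto intro: inj TkN)
  have "range (\<lambda>i. p ((T ^^ i) m)) \<subseteq> span (p ` F)"
    using TkN[OF m] F(2) span_Un_kernel[OF p(1,2)] by blast
  then obtain j where "p ((T ^^ j) m) \<in> span ((\<lambda>i. p ((T ^^ i) m)) ` {j<..})"
    using infinite_sequence_dependent[of "p ` F"] F(1) by blast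
  also have "(\<lambda>i. p ((T ^^ i) m)) ` {j<..} = p ` (\<lambda>i. (T ^^ i) m) ` {j<..}"
    by (simp add: image_image)
  finally obtain w where w: "w \<in> span ((\<lambda>i. (T ^^ i) m) ` {j<..})" "p ((T ^^ j) m) = p w"
    unfolding span_linear_image[OF p(1)] by auto
  \<comment> \<open>Every iterate after the \<open>j\<close>-th factors through
    \<open>T ^^ Suc j\<close>, and the image of \<open>N\<close> under that power is a subspace, so
    it contains \<open>w\<close>.\<close>
  have "(\<lambda>i. (T ^^ i) m) ` {j<..} \<subseteq> (T ^^ Suc j) ` N"
  proof safe
    fix i assume "i > j"
    then have "(T ^^ i) m = (T ^^ Suc j) ((T ^^ (i - Suc j)) m)"
      by (metis Suc_leI comp_apply funpow_add le_add_diff_inverse)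
    then show "(T ^^ i) m \<in> (T ^^ Suc j) ` N" using TkN[OF m] by blast
  qed
  then have "w \<in> (T ^^ Suc j) ` N"
    using w(1) span_minimal[OF _ subspace_linear_image[OF linear_funpow[OF T] N]] by blast
  then obtain u where u: "u \<in> N" "w = (T ^^ j) (T u)"
    by (auto simp: funpow_Suc_right simp del: funpow.simps)
  have "(T ^^ j) (T u - m) = w - (T ^^ j) m"
    using u(2) linear_simps(5)[OF linear_funpow[OF T]] by simp
  \<comment> \<open>The subtracted term is zero, since \<open>p\<close> agrees on \<open>w\<close>
    and \<open>(T ^^ j) m\<close>.\<close>
  also have "\<dots> = (w - (T ^^ j) m) - p (w - (T ^^ j) m)"
    using w(2) linear_simps(5)[OF p(1)] by simp
  also have "\<dots> \<in> W" by (rule p(3))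
  finally have "T u - m \<in> W"
    using Tk_inj[of "T u - m" j] subspace_diff[OF N TN[OF u(1)] m] by blast
  then show ?thesis using u(1) by blast
qed

text \<open>Preimages modulo \<open>W\<close> are chosen on a basis of \<open>N\<close> and extended
  linearly; the error depends linearly on \<open>m\<close> and so remains in
  \<open>W\<close>.\<close>

lemma linear_right_inverse_mod_subspace:
  assumes T: "Vector_Spaces.linear scale scale T"
    and N: "subspace N" and W: "subspace W"
    and surj: "\<And>m. m \<in> N \<Longrightarrow> \<exists>m'\<in>N. T m' - m \<in> W"
  obtains R where "Vector_Spaces.linear scale scale R" "\<And>m. m \<in> N \<Longrightarrow> R m \<in> N"
    "\<And>m. m \<in> N \<Longrightarrow> T (R m) - m \<in> W"
proof -
  interpret p: vector_space_pair scale scale by unfold_locales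
  obtain B where B: "B \<subseteq> N" "independent B" "N \<subseteq> span B"
    using maximal_independent_subset by blast
  obtain r where r: "\<And>m. m \<in> N \<Longrightarrow> r m \<in> N \<and> T (r m) - m \<in> W"
    using surj by metis
  obtain R where R: "Vector_Spaces.linear scale scale R" "\<forall>x\<in>B. R x = r x"
    using p.linear_independent_extend[OF B(2), of r] by blast
  have "R m \<in> N \<and> T (R m) - m \<in> W" if "m \<in> N" for m
  proof -
    have "m \<in> span B" using that B by blast
    then show ?thesis
    proof (induction rule: span_induct_alt)
      case base
      then show ?case
        using subspace_0[OF N] subspace_0[OF W] by (simp add: linear_simps[OF R(1)] linear_simps[OF T])
    next
      case (step c x y)
      have x: "R x \<in> N" "T (R x) - x \<in> W" using step(1) R(2) r B(1) by auto
      then have "scale c (T (R x) - x) + (T (R y) - y) \<in> W" "scale c (R x) + R y \<in> N"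
        using step(2) N W by (auto intro!: subspace_add subspace_scale)
      then show ?case
        by (simp add: linear_simps[OF R(1)] linear_simps[OF T] scale_right_diff_distrib algebra_simps)
    qed
  qed
  then show thesis using that R(1) by blast
qed

text \<open>A basis of \<open>W\<close> extends properly to one of \<open>V\<close>; the finite
  \<open>F\<close> makes the bases finite, so that their cardinalities differ.\<close>

lemma dim_strict_mono:
  assumes V: "subspace V" and W: "subspace W" "W \<subset> V" and F: "finite F" "V \<subseteq> span F"
  shows "dim W < dim V"
proof -
  obtain B where B: "B \<subseteq> W" "independent B" "W \<subseteq> span B" "card B = dim W"
    by (rule basis_exists)
  obtain B' where B': "B \<subseteq> B'" "B' \<subseteq> V" "independent B'" "V \<subseteq> span B'"
    using maximal_independent_subset_extend[of B V] B W(2) by blast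
  have "finite B'" using independent_span_bound[OF F(1) B'(3)] B'(2) F(2) by blast
  moreover have "B \<noteq> B'"
    using B'(4) span_minimal[OF B(1) W(1)] W(2) by blast
  ultimately have "card B < card B'" using B'(1) by (intro psubset_card_mono) auto
  then show ?thesis using B(4) basis_card_eq_dim[OF B'(2,4,3)] by simp
qed

end

section \<open>Nilpotency and the Fitting null component\<close>

lemma funpow_add_distrib:
  fixes T :: "'a::ab_group_add \<Rightarrow> 'a"
  assumes "\<And>x y. T (x + y) = T x + T y"
  shows "(T ^^ k) (x + y) = (T ^^ k) x + (T ^^ k) y"
  by (induction k) (simp_all add: assms)

lemma funpow_zero_mono:
  fixes T :: "'a::zero \<Rightarrow> 'a"
  assumes "T 0 = 0" "(T ^^ k) x = 0" "k \<le> l"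
  shows "(T ^^ l) x = 0"
proof -
  have "(T ^^ j) 0 = 0" for j using assms(1) by (induction j) auto
  moreover have "(T ^^ l) x = (T ^^ (l - k)) ((T ^^ k) x)"
    using assms(3) by (metis comp_apply funpow_add le_add_diff_inverse2)
  ultimately show ?thesis using assms(2) by simp
qed

text \<open>Each application of \<open>T\<close> lowers the exponent left for \<open>a\<close> or
  for \<open>b\<close>, so induction on i + j replaces the binomial expansion. The pairing
  \<open>p\<close> is general in order to cover both module actions.\<close>

lemma derivation_nilpotent:
  fixes T :: "'c::ab_group_add \<Rightarrow> 'c" and p :: "'a::zero \<Rightarrow> 'd::zero \<Rightarrow> 'c"
  assumes add: "\<And>x y. T (x + y) = T x + T y"
    and p0: "\<And>b. p 0 b = 0" "\<And>a. p a 0 = 0"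
    and der: "\<And>a b. T (p a b) = p (U a) b + p a (V b)"
    and "(U ^^ i) a = 0" "(V ^^ j) b = 0"
  shows "(T ^^ (i + j)) (p a b) = 0"
  using assms(5,6)
proof (induction "i + j" arbitrary: i j a b)
  case 0
  then show ?case by (simp add: p0)
next
  case (Suc k)
  have T0: "T 0 = 0" using add[of 0 0] by simp
  have z: "(T ^^ l) 0 = 0" for l using T0 by (induction l) auto
  show ?case
  proof (cases "i = 0 \<or> j = 0")
    case True
    \<comment> \<open>An exponent 0 means that \<open>a\<close> or \<open>b\<close> itself is
      0.\<close>
    then show ?thesis using Suc.prems by (auto simp: p0 z)
  next
    case False
    then obtain i' j' where ij: "i = Suc i'" "j = Suc j'" by (metis not0_implies_Suc)
    then have k: "k = i' + j" "k = i + j'" using Suc.hyps(2) by auto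
    have "(U ^^ i') (U a) = 0" "(V ^^ j') (V b) = 0"
      using Suc.prems ij by (auto simp: funpow_swap1)
    then have "(T ^^ k) (p (U a) b) = 0" "(T ^^ k) (p a (V b)) = 0"
      using Suc.hyps(1)[OF k(1)] Suc.hyps(1)[OF k(2)] Suc.prems k by auto
    then have "(T ^^ k) (T (p a b)) = 0"
      by (simp add: der funpow_add_distrib[of T, OF add])
    then show ?thesis using Suc(2)[symmetric] by (simp add: funpow_swap1)
  qed
qed

text \<open>The union defining \<open>fitting_null\<close> starts at exponent 1; exponent 0 forces
  \<open>v = 0\<close>, which \<open>T\<close> itself kills.\<close>

lemma fitting_null_iff:
  assumes "T 0 = 0"
  shows "v \<in> fitting_null T \<longleftrightarrow> (\<exists>n. (T ^^ n) v = 0)"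
proof
  assume "\<exists>n. (T ^^ n) v = 0"
  then obtain n where "(T ^^ n) v = 0" by blast
  then have "(T ^^ Suc n) v = 0" using assms by simp
  then show "v \<in> fitting_null T" unfolding fitting_null_def by fastforce
qed (auto simp: fitting_null_def)

context leibniz_bimodule
begin

lemma fitting_null_lact_iff: "m \<in> fitting_null (lact s) \<longleftrightarrow> (\<exists>n. (lact s ^^ n) m = 0)"
  by (simp add: fitting_null_iff)

text \<open>One more power of \<open>lact s\<close> kills \<open>m\<close>. This is injectivity of
  \<open>s\<close> modulo its null component.\<close>

lemma fitting_null_lactD: "lact s m \<in> fitting_null (lact s) \<Longrightarrow> m \<in> fitting_null (lact s)"
  unfolding fitting_null_lact_iff by (metis comp_apply funpow_Suc_right)

lemma subspace_fitting_null: "M.subspace (fitting_null (lact s))"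
proof (rule M.subspaceI)
  show "0 \<in> fitting_null (lact s)" unfolding fitting_null_lact_iff by (intro exI[of _ 0]) simp
next
  fix m m' assume "m \<in> fitting_null (lact s)" "m' \<in> fitting_null (lact s)"
  then obtain i j where ij: "(lact s ^^ i) m = 0" "(lact s ^^ j) m' = 0"
    unfolding fitting_null_lact_iff by blast
  have "(lact s ^^ (i + j)) m = 0" "(lact s ^^ (i + j)) m' = 0"
    by (rule funpow_zero_mono[of "lact s", OF lact_0(1)], use ij in auto)+
  then have "(lact s ^^ (i + j)) (m + m') = 0"
    by (simp add: funpow_add_distrib[of "lact s", OF lact_simps(1)])
  then show "m + m' \<in> fitting_null (lact s)" unfolding fitting_null_lact_iff by blast
next
  fix c m assume "m \<in> fitting_null (lact s)"
  moreover have "(lact s ^^ n) (scaleM c m) = scaleM c ((lact s ^^ n) m)" for n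
    by (induction n) (simp_all add: lact_simps)
  ultimately show "scaleM c m \<in> fitting_null (lact s)"
    unfolding fitting_null_lact_iff by (metis M.scale_zero_right)
qed

text \<open>By \<open>LLM\<close> and \<open>LML\<close>, \<open>lact s\<close> is a derivation of
  both actions over \<open>lmul s\<close>: s(xm) = (sx)m + x(sm) and s(mx) = (sm)x + m(sx).\<close>

lemma subbimodule_fitting_null:
  assumes "locally_nilpotent (lmul s)"
  shows "subbimodule (fitting_null (lact s))"
  unfolding subbimodule_def
proof (intro conjI allI ballI subspace_fitting_null)
  fix x m assume "m \<in> fitting_null (lact s)"
  then obtain j where j: "(lact s ^^ j) m = 0" unfolding fitting_null_lact_iff by blast
  obtain i where i: "(lmul s ^^ i) x = 0" using assms unfolding locally_nilpotent_def by blast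
  have "(lact s ^^ (i + j)) (lact x m) = 0"
    by (rule derivation_nilpotent[where U = "lmul s" and V = "lact s"])
      (use i j in \<open>auto simp: lact_simps LLM\<close>)
  then show "lact x m \<in> fitting_null (lact s)" unfolding fitting_null_lact_iff by blast
  have "(lact s ^^ (j + i)) (ract m x) = 0"
    by (rule derivation_nilpotent[where V = "lmul s" and U = "lact s"])
      (use i j in \<open>auto simp: lact_simps LML\<close>)
  then show "ract m x \<in> fitting_null (lact s)" unfolding fitting_null_lact_iff by blast
qed

lemma subbimodule_Int: "subbimodule N \<Longrightarrow> subbimodule N' \<Longrightarrow> subbimodule (N \<inter> N')"
  by (auto simp: subbimodule_def M.subspace_inter)

lemma subbimodule_fitting_null_set:
  assumes "\<forall>s\<in>S. locally_nilpotent (lmul s)"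
  shows "subbimodule (fitting_null_set lact S)"
proof -
  have "subbimodule (fitting_null (lact s))" if "s \<in> S" for s
    using assms that by (intro subbimodule_fitting_null) auto
  then show ?thesis
    unfolding subbimodule_def fitting_null_set_def by (auto intro!: M.subspace_Inter)
qed

end

section \<open>Inverting the induced action modulo a subbimodule\<close>

text \<open>Induction on the sum of the nilpotency orders of the entries: applying \<open>T\<close>
  to a nonzero entry lowers its order. Zero entries have order 0 and are left to multilinearity in
  the applications.\<close>

lemma nilpotent_slots_induct [consumes 1, case_names step]:
  fixes T :: "'a::zero \<Rightarrow> 'a"
  assumes T: "locally_nilpotent T"
    and step: "\<And>xs. (\<And>i. i < length xs \<Longrightarrow> xs ! i \<noteq> 0 \<Longrightarrow> P (xs[i := T (xs ! i)])) \<Longrightarrow> P xs"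
  shows "P xs"
proof -
  define \<nu> where "\<nu> x = (LEAST k. (T ^^ k) x = 0)" for x
  have \<nu>: "(T ^^ \<nu> x) x = 0" for x
    using T LeastI_ex[of "\<lambda>k. (T ^^ k) x = 0"] unfolding locally_nilpotent_def \<nu>_def by blast
  have less: "\<nu> (T x) < \<nu> x" if x: "x \<noteq> 0" for x
  proof -
    obtain k where k: "\<nu> x = Suc k"
      using \<nu>[of x] x by (cases "\<nu> x") auto
    then have "(T ^^ k) (T x) = 0" using \<nu>[of x] by (simp add: funpow_swap1)
    then have "\<nu> (T x) \<le> k" unfolding \<nu>_def by (rule Least_le)
    then show ?thesis using k by simp
  qed
  show ?thesis
  proof (induction xs rule: measure_induct_rule[of "\<lambda>xs. sum_list (map \<nu> xs)"])
    case (less xs)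
    show ?case
    proof (rule step)
      fix i assume i: "i < length xs" "xs ! i \<noteq> 0"
      have "map \<nu> xs ! i \<le> sum_list (map \<nu> xs)" by (rule elem_le_sum_list) (use i in simp)
      then have "sum_list (map \<nu> (xs[i := T (xs ! i)])) < sum_list (map \<nu> xs)"
        using i \<open>\<And>x. x \<noteq> 0 \<Longrightarrow> \<nu> (T x) < \<nu> x\<close>[of "xs ! i"]
        by (simp add: map_update sum_list_update)
      then show "P (xs[i := T (xs ! i)])" by (rule less.IH)
    qed
  qed
qed

text \<open>A slot sum evaluates its function at finitely many lists, so pointwise stabilisation
  passes through it.\<close>

lemma eventually_slot_sum_eq:
  assumes "\<And>xs. \<forall>\<^sub>F K in \<F>. F K xs = f xs"
  shows "\<forall>\<^sub>F K in \<F>. slot_sum T (F K) xs = slot_sum T f xs"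
  using assms
proof (induction xs arbitrary: F f)
  case (Cons x xs)
  have "\<forall>\<^sub>F K in \<F>. slot_sum T (\<lambda>ys. F K (x # ys)) xs = slot_sum T (\<lambda>ys. f (x # ys)) xs"
    by (rule Cons.IH) (rule Cons.prems)
  moreover have "\<forall>\<^sub>F K in \<F>. F K (T x # xs) = f (T x # xs)" by (rule Cons.prems)
  ultimately show ?case by eventually_elim simp
qed simp

context leibniz_bimodule
begin

lemma cochain_restrict:
  "f \<in> C n N \<Longrightarrow> (\<And>xs. length xs = n \<Longrightarrow> f xs \<in> N') \<Longrightarrow> f \<in> C n N'"
  by (simp add: cochains_def)

lemma cochain_zero_slot:
  assumes f: "f \<in> C n N" and i: "i < length xs" "xs ! i = 0"
  shows "f xs = 0"
proof (cases "length xs = n")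
  case True
  then have "Vector_Spaces.linear scaleL scaleM (\<lambda>x. f (xs[i := x]))"
    using f i unfolding cochains_def by blast
  then have "f (xs[i := scaleL 0 0]) = scaleM 0 (f (xs[i := 0]))"
    unfolding linear_iff_LM by blast
  then show ?thesis using i(2) list_update_id[of xs i] by simp
qed (rule cochain_length[OF f])

text \<open>Each defining condition involves at most three values of the map, and one index
  \<open>K\<close> serves them all.\<close>

lemma cochain_limit:
  assumes F: "\<And>K::nat. F K \<in> C n N" and lim: "\<And>xs. \<forall>\<^sub>F K in sequentially. F K xs = f xs"
  shows "f \<in> C n N"
proof -
  have ev: "\<exists>K. F K xs = f xs \<and> F K ys = f ys \<and> F K zs = f zs" for xs ys zs
  proof -
    have "\<forall>\<^sub>F K in sequentially. F K xs = f xs \<and> F K ys = f ys \<and> F K zs = f zs"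
      using lim[of xs] lim[of ys] lim[of zs] by eventually_elim blast
    then show ?thesis by (rule eventually_happens'[rotated]) simp
  qed
  show ?thesis
    unfolding cochains_def linear_iff_LM
  proof (intro CollectI conjI allI impI)
    show "f xs \<in> N" if "length xs = n" for xs
      using ev[of xs xs xs] cochain_mem[OF F that] by metis
    show "f xs = 0" if "length xs \<noteq> n" for xs
      using ev[of xs xs xs] cochain_length[OF F that] by metis
    fix xs :: "'l list" and i assume xs: "length xs = n" "i < n"
    have l: "F K (xs[i := x + y]) = F K (xs[i := x]) + F K (xs[i := y])"
      "F K (xs[i := scaleL c x]) = scaleM c (F K (xs[i := x]))" for K x y c
      using F[of K] xs unfolding cochains_def linear_iff_LM by auto
    show "f (xs[i := x + y]) = f (xs[i := x]) + f (xs[i := y])" for x y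
      using ev[of "xs[i := x + y]" "xs[i := x]" "xs[i := y]"] l(1) by metis
    show "f (xs[i := scaleL c x]) = scaleM c (f (xs[i := x]))" for x c
      using ev[of "xs[i := scaleL c x]" "xs[i := x]" "xs[i := x]"] l(2) by metis
  qed
qed

lemma cochain_slot_sum_funpow:
  assumes "M.subspace N" "Vector_Spaces.linear scaleL scaleL T" "f \<in> C n N"
  shows "(slot_sum T ^^ k) f \<in> C n N"
  using assms by (induction k) (auto intro: cochain_slot_sum)

text \<open>An iterate at \<open>xs\<close> is a sum of values of the previous iterate at lists with
  one entry moved by \<open>T\<close>, so induction over the slots applies. The exponent depends on
  \<open>xs\<close>, hence the filter.\<close>

lemma slot_sum_locally_nilpotent:
  assumes T: "Vector_Spaces.linear scaleL scaleL T" "locally_nilpotent T"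
    and f: "f \<in> C n UNIV"
  shows "\<forall>\<^sub>F k in sequentially. (slot_sum T ^^ k) f xs = 0"
  using T(2)
proof (induction xs rule: nilpotent_slots_induct)
  case (step xs)
  have "\<forall>\<^sub>F k in sequentially. (slot_sum T ^^ k) f (xs[i := T (xs ! i)]) = 0" if "i < length xs" for i
  proof (cases "xs ! i = 0")
    case True
    have "T 0 = 0" using T(1) by (rule L.linear_simps)
    then have "(slot_sum T ^^ k) f (xs[i := T (xs ! i)]) = 0" for k
      using True that
      by (intro cochain_zero_slot[OF cochain_slot_sum_funpow[OF _ T(1) f], where i = i]) auto
    then show ?thesis by simp
  qed (use step that in blast)
  then have "\<forall>\<^sub>F k in sequentially. \<forall>i\<in>{..<length xs}. (slot_sum T ^^ k) f (xs[i := T (xs ! i)]) = 0"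
    by (intro eventually_ball_finite) auto
  then have "\<forall>\<^sub>F k in sequentially. (slot_sum T ^^ Suc k) f xs = 0"
    by eventually_elim (simp add: slot_sum_eq_sum)
  then show ?case by (simp only: eventually_sequentially_Suc[of "\<lambda>k. (slot_sum T ^^ k) f xs = 0"])
qed

text \<open>By induction over the slots, \<open>f\<close> takes values in \<open>N'\<close> once an
  entry of \<open>xs\<close> has been multiplied by \<open>s\<close>. So the slot sum at
  \<open>xs\<close> lies in \<open>N'\<close>, hence so does \<open>lact s (f xs)\<close>, and
  \<open>inj\<close> applies.\<close>

lemma lie_injective_mod:
  assumes N: "subbimodule N" "subbimodule N'"
    and s: "locally_nilpotent (lmul s)"
    and inj: "\<And>m. m \<in> N \<Longrightarrow> lact s m \<in> N' \<Longrightarrow> m \<in> N'"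
    and f: "f \<in> C n N" and lf: "lie s f \<in> C n N'"
  shows "f \<in> C n N'"
proof (rule cochain_restrict[OF f])
  note N' = subbimoduleD(1)[OF N(2)]
  have "length xs = n \<longrightarrow> f xs \<in> N'" for xs
    using s
  proof (induction xs rule: nilpotent_slots_induct)
    case (step xs)
    show ?case
    proof
      assume xs: "length xs = n"
      have "f (xs[i := lmul s (xs ! i)]) \<in> N'" if "i < length xs" for i
      proof (cases "xs ! i = 0")
        case True
        then have "f (xs[i := lmul s (xs ! i)]) = 0"
          using that by (intro cochain_zero_slot[OF f, where i = i]) auto
        then show ?thesis using M.subspace_0[OF N'] by simp
      qed (use step that xs in simp)
      then have "slot_sum (lmul s) f xs \<in> N'"
        unfolding slot_sum_eq_sum by (intro M.subspace_sum[OF N']) simp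
      moreover have "lie s f xs \<in> N'" by (rule cochain_mem[OF lf xs])
      ultimately have "lie s f xs + slot_sum (lmul s) f xs \<in> N'" by (intro M.subspace_add[OF N'])
      then show "f xs \<in> N'" using inj cochain_mem[OF f xs] by (simp add: lie_def)
    qed
  qed
  then show "length xs = n \<Longrightarrow> f xs \<in> N'" for xs by blast
qed

text \<open>Modulo \<open>N'\<close>, the operator \<open>lie s\<close> is the invertible action of \<open>s\<close> minus the commuting
  locally nilpotent operator \<open>B = slot_sum (lmul s)\<close>, so it is inverted by the geometric series
  \<open>\<Sum>k. R\<^bsup>k+1\<^esup> B\<^bsup>k\<^esup>\<close>, where \<open>R\<close> inverts the action of \<open>s\<close> modulo \<open>N'\<close>.\<close>

lemma lie_surjective_mod:
  assumes N: "subbimodule N" "subbimodule N'"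
    and s: "locally_nilpotent (lmul s)"
    and surj: "\<And>m. m \<in> N \<Longrightarrow> \<exists>m'\<in>N. lact s m' - m \<in> N'"
    and g: "g \<in> C n N"
  shows "\<exists>f\<in>C n N. \<forall>xs. lie s f xs - g xs \<in> N'"
proof -
  note NN = subbimoduleD(1)[OF N(1)] and NN' = subbimoduleD(1)[OF N(2)]
  obtain R where R: "Vector_Spaces.linear scaleM scaleM R" "\<And>m. m \<in> N \<Longrightarrow> R m \<in> N"
    "\<And>m. m \<in> N \<Longrightarrow> lact s (R m) - m \<in> N'"
    by (rule M.linear_right_inverse_mod_subspace[OF linear_lact_module NN NN' surj]) blast+
  note Rk = M.linear_simps[OF M.linear_funpow[OF R(1)]]
  have RkN: "m \<in> N \<Longrightarrow> (R ^^ k) m \<in> N" for k m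
    by (induction k) (auto intro: R(2))
  define b where "b k = (slot_sum (lmul s) ^^ k) g" for k
  have b: "b k \<in> C n N" for k
    unfolding b_def by (rule cochain_slot_sum_funpow[OF NN L.linear_lmul_right g])
  have bN: "b k xs \<in> N" for k xs
    using cochain_mem[OF b] cochain_length[OF b] M.subspace_0[OF NN] by metis
  have b0: "b 0 = g" by (simp add: b_def)
  have bS: "slot_sum (lmul s) (b k) = b (Suc k)" for k by (simp add: b_def)
  have b_lim: "\<forall>\<^sub>F k in sequentially. b k xs = 0" for xs
    unfolding b_def
    by (rule slot_sum_locally_nilpotent[OF L.linear_lmul_right s cochain_mono[OF g subset_UNIV]])
  define F where "F K xs = (\<Sum>k<K. (R ^^ Suc k) (b k xs))" for K xs
  have F0: "F 0 xs = 0" and FS: "F (Suc K) xs = F K xs + (R ^^ Suc K) (b K xs)" for K xs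
    by (simp_all add: F_def)
  have F: "F K \<in> C n N" for K
  proof (induction K)
    case 0
    then show ?case using cochain_zero[OF M.subspace_0[OF NN], of n] by (simp add: F0[abs_def])
  next
    case (Suc K)
    have "(\<lambda>xs. F K xs + (R ^^ Suc K) (b K xs)) \<in> C n N"
      by (intro cochain_add NN Suc cochain_map[OF b] Rk RkN)
    then show ?case by (simp only: FS[abs_def])
  qed
  \<comment> \<open>Telescoping: modulo \<open>N'\<close> the partial sum solves the equation up to
    the remainder \<open>(R ^^ K) (b K xs)\<close>, which vanishes for large
    \<open>K\<close>.\<close>
  have key: "lie s (F K) xs - g xs + (R ^^ K) (b K xs) \<in> N'" for K xs
  proof (induction K)
    case 0
    have "lie s (F 0) xs = 0"
      by (simp add: lie_def F0[abs_def] slot_sum_zero)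
    then show ?case using M.subspace_0[OF NN'] by (simp add: b0)
  next
    case (Suc K)
    \<comment> \<open>Powers of \<open>R\<close> act on values and the slot sum on arguments, so
      they commute.\<close>
    have "slot_sum (lmul s) (\<lambda>ys. (R ^^ Suc K) (b K ys)) xs = (R ^^ Suc K) (b (Suc K) xs)"
      by (subst slot_sum_linear) (simp_all only: Rk bS)
    then have "lie s (F (Suc K)) xs
        = lie s (F K) xs + (lact s ((R ^^ Suc K) (b K xs)) - (R ^^ Suc K) (b (Suc K) xs))"
      unfolding FS[abs_def] lie_add by (simp only: lie_def[of s "\<lambda>ys. (R ^^ Suc K) (b K ys)"])
    then have "lie s (F (Suc K)) xs - g xs + (R ^^ Suc K) (b (Suc K) xs)
        = (lie s (F K) xs - g xs + (R ^^ K) (b K xs))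
          + (lact s (R ((R ^^ K) (b K xs))) - (R ^^ K) (b K xs))"
      by simp
    also have "\<dots> \<in> N'" by (intro M.subspace_add[OF NN'] Suc R(3) RkN bN)
    finally show ?case .
  qed
  \<comment> \<open>At a fixed list all but finitely many terms of the series vanish, so the partial
    sums stabilise pointwise.\<close>
  have "\<exists>y. \<forall>\<^sub>F K in sequentially. F K xs = y" for xs
  proof -
    obtain K0 where K0: "\<And>k. k \<ge> K0 \<Longrightarrow> b k xs = 0"
      using b_lim[of xs] unfolding eventually_sequentially by blast
    have "F K xs = F K0 xs" if "K \<ge> K0" for K
      using that by (induction rule: dec_induct) (simp_all add: FS K0 Rk(3) del: funpow.simps)
    then show ?thesis unfolding eventually_sequentially by blast
  qed
  then obtain f where f: "\<And>xs. \<forall>\<^sub>F K in sequentially. F K xs = f xs" by metis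
  have "lie s f xs - g xs \<in> N'" for xs
  proof -
    have "\<forall>\<^sub>F K in sequentially. lie s f xs - g xs \<in> N'"
      using f[of xs] b_lim[of xs] eventually_slot_sum_eq[of F f sequentially "lmul s" xs, OF f]
    proof eventually_elim
      case (elim K)
      then have "lie s (F K) xs = lie s f xs" by (simp add: lie_def)
      then show ?case using key[of K xs] elim by (simp add: Rk)
    qed
    then show ?thesis by simp
  qed
  then show ?thesis using cochain_limit[OF F f] by blast
qed

end

section \<open>Quotient spaces\<close>

lemma mem_vcoset_iff: "x \<in> vcoset W v \<longleftrightarrow> x - v \<in> W"
  unfolding vcoset_def by (auto simp: image_iff intro!: bexI[of _ "x - v"])

context Vector_Spaces.vector_space
begin

lemma vcoset_eq_iff:
  assumes W: "subspace W"
  shows "vcoset W x = vcoset W y \<longleftrightarrow> x - y \<in> W"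
proof
  assume "vcoset W x = vcoset W y"
  moreover have "x \<in> vcoset W x" using subspace_0[OF W] by (simp add: mem_vcoset_iff)
  ultimately show "x - y \<in> W" by (simp add: mem_vcoset_iff)
next
  assume a: "x - y \<in> W"
  have "z - x \<in> W \<longleftrightarrow> z - y \<in> W" for z
    using subspace_add[OF W _ a, of "z - x"] subspace_diff[OF W _ a, of "z - y"] by auto
  then show "vcoset W x = vcoset W y" by (auto simp: mem_vcoset_iff)
qed

lemma quotient_space_ops:
  assumes W: "subspace W"
  shows "carrier (quotient_space scale V W) = vcoset W ` V"
    "zero (quotient_space scale V W) = vcoset W 0"
    "add (quotient_space scale V W) (vcoset W x) (vcoset W y) = vcoset W (x + y)"
    "smult (quotient_space scale V W) c (vcoset W x) = vcoset W (scale c x)"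
proof -
  show "carrier (quotient_space scale V W) = vcoset W ` V"
    "zero (quotient_space scale V W) = vcoset W 0"
    by (auto simp: quotient_space_def mem_vcoset_iff)
  have "z - (x + y) \<in> W \<longleftrightarrow> (\<exists>a b. z = a + b \<and> a - x \<in> W \<and> b - y \<in> W)" for z
  proof
    assume "z - (x + y) \<in> W"
    then have "z = x + (z - x)" "x - x \<in> W" "(z - x) - y \<in> W"
      using subspace_0[OF W] by (auto simp: algebra_simps)
    then show "\<exists>a b. z = a + b \<and> a - x \<in> W \<and> b - y \<in> W" by blast
  next
    assume "\<exists>a b. z = a + b \<and> a - x \<in> W \<and> b - y \<in> W"
    then obtain a b where ab: "z = a + b" "a - x \<in> W" "b - y \<in> W" by blast
    then show "z - (x + y) \<in> W" using subspace_add[OF W ab(2,3)] by (simp add: algebra_simps)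
  qed
  then show "add (quotient_space scale V W) (vcoset W x) (vcoset W y) = vcoset W (x + y)"
    by (simp add: quotient_space_def set_eq_iff mem_vcoset_iff)
  have "z - scale c x \<in> W \<longleftrightarrow> (\<exists>a w. z = scale c a + w \<and> a - x \<in> W \<and> w \<in> W)" for z
  proof
    assume "z - scale c x \<in> W"
    then have "z = scale c x + (z - scale c x)" "x - x \<in> W" "z - scale c x \<in> W"
      using subspace_0[OF W] by auto
    then show "\<exists>a w. z = scale c a + w \<and> a - x \<in> W \<and> w \<in> W" by blast
  next
    assume "\<exists>a w. z = scale c a + w \<and> a - x \<in> W \<and> w \<in> W"
    then obtain a w where aw: "z = scale c a + w" "a - x \<in> W" "w \<in> W" by blast
    then show "z - scale c x \<in> W"
      using subspace_add[OF W subspace_scale[OF W aw(2), of c] aw(3)]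
      by (simp add: scale_right_diff_distrib algebra_simps)
  qed
  then show "smult (quotient_space scale V W) c (vcoset W x) = vcoset W (scale c x)"
    by (simp add: quotient_space_def set_eq_iff mem_vcoset_iff)
qed

text \<open>A form of the second isomorphism theorem: every class modulo \<open>W\<close> has a
  representative in \<open>V'\<close>. The map is intersection with \<open>V'\<close>, which avoids
  choosing representatives.\<close>

lemma vs_isomorphic_quotient_space:
  assumes V: "subspace V" "subspace V'" and W: "subspace W" "subspace W'"
    and sub: "V' \<subseteq> V" and sum: "\<And>v. v \<in> V \<Longrightarrow> \<exists>v'\<in>V'. v - v' \<in> W" and Int: "W \<inter> V' = W'"
  shows "vs_isomorphic (quotient_space scale V W) (quotient_space scale V' W')"
proof -
  let ?\<phi> = "\<lambda>X. X \<inter> V'"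
  have \<phi>: "?\<phi> (vcoset W v) = vcoset W' v" if v: "v \<in> V'" for v
  proof -
    have mem: "x \<in> V' \<longleftrightarrow> x - v \<in> V'" for x
      using subspace_add[OF V(2) _ v, of "x - v"] subspace_diff[OF V(2) _ v, of x] by auto
    show ?thesis unfolding set_eq_iff Int_iff mem_vcoset_iff using Int mem by blast
  qed
  have rep: "\<exists>v'\<in>V'. X = vcoset W v'" if "X \<in> vcoset W ` V" for X
    using that sum by (auto simp: vcoset_eq_iff[OF W(1)])
  note ops = quotient_space_ops[OF W(1), of V] quotient_space_ops[OF W(2), of V']
  have "?\<phi> \<in> LinearCombinations.module_hom class_ring (quotient_space scale V W) (quotient_space scale V' W')"
    unfolding LinearCombinations.module_hom_def ops
  proof (intro CollectI conjI allI impI funcsetI)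
    show "?\<phi> X \<in> vcoset W' ` V'" if "X \<in> vcoset W ` V" for X
      using rep[OF that] \<phi> by auto
    show "?\<phi> (X \<oplus>\<^bsub>quotient_space scale V W\<^esub> Y) = ?\<phi> X \<oplus>\<^bsub>quotient_space scale V' W'\<^esub> ?\<phi> Y"
      if XY: "X \<in> vcoset W ` V \<and> Y \<in> vcoset W ` V" for X Y
    proof -
      obtain x y where xy: "x \<in> V'" "X = vcoset W x" "y \<in> V'" "Y = vcoset W y"
        using XY rep by metis
      show ?thesis unfolding xy(2,4) ops \<phi>[OF xy(1)] \<phi>[OF xy(3)]
        by (rule \<phi>[OF subspace_add[OF V(2) xy(1,3)]])
    qed
    show "?\<phi> (c \<odot>\<^bsub>quotient_space scale V W\<^esub> X) = c \<odot>\<^bsub>quotient_space scale V' W'\<^esub> ?\<phi> X"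
      if cX: "c \<in> carrier class_ring \<and> X \<in> vcoset W ` V" for c X
    proof -
      obtain x where x: "x \<in> V'" "X = vcoset W x" using cX rep by metis
      show ?thesis unfolding x(2) ops \<phi>[OF x(1)]
        by (rule \<phi>[OF subspace_scale[OF V(2) x(1)]])
    qed
  qed
  moreover have "vectorspace class_ring (quotient_space scale V W)"
    "vectorspace class_ring (quotient_space scale V' W')"
    by (intro vectorspace_quotient_space vector_space_axioms V W)+
  ultimately have "linear_map class_ring (quotient_space scale V W) (quotient_space scale V' W') ?\<phi>"
    by (simp add: linear_map_def mod_hom_def mod_hom_axioms_def vectorspace_def)
  moreover have "bij_betw ?\<phi> (vcoset W ` V) (vcoset W' ` V')"
    unfolding bij_betw_def
  proof
    show "inj_on ?\<phi> (vcoset W ` V)"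
    proof (rule inj_onI)
      fix X Y assume XY: "X \<in> vcoset W ` V" "Y \<in> vcoset W ` V" "?\<phi> X = ?\<phi> Y"
      obtain x y where xy: "x \<in> V'" "X = vcoset W x" "y \<in> V'" "Y = vcoset W y"
        using XY rep by metis
      then have "vcoset W' x = vcoset W' y" using XY(3) \<phi> by simp
      then show "X = Y" unfolding xy vcoset_eq_iff[OF W(1)] vcoset_eq_iff[OF W(2)]
        using Int by blast
    qed
    show "?\<phi> ` vcoset W ` V = vcoset W' ` V'"
    proof
      show "?\<phi> ` vcoset W ` V \<subseteq> vcoset W' ` V'"
      proof safe
        fix v assume "v \<in> V"
        then obtain v' where "v' \<in> V'" "vcoset W v = vcoset W v'" using rep by blast
        then show "vcoset W v \<inter> V' \<in> vcoset W' ` V'" using \<phi> by auto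
      qed
      show "vcoset W' ` V' \<subseteq> ?\<phi> ` vcoset W ` V"
      proof safe
        fix v assume "v \<in> V'"
        then show "vcoset W' v \<in> ?\<phi> ` vcoset W ` V" using \<phi>[symmetric] sub by blast
      qed
    qed
  qed
  ultimately show ?thesis unfolding vs_isomorphic_def ops by blast
qed

text \<open>\<open>F\<close> consists of representatives of a finite generating set of the quotient.
  The cosets of elements of \<open>span (F \<union> W)\<close> form a submodule containing the
  generators, hence are all cosets.\<close>

lemma finite_codimension_span:
  assumes W: "subspace W" and fd: "vectorspace.fin_dim class_ring (quotient_space scale UNIV W)"
  shows "\<exists>F. finite F \<and> span (F \<union> W) = UNIV"
proof -
  let ?Q = "quotient_space scale UNIV W"
  note ops = quotient_space_ops[OF W, of UNIV]
  interpret Q: vectorspace class_ring ?Q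
    by (rule vectorspace_quotient_space[OF vector_space_axioms subspace_UNIV W])
  have Q: "carrier ?Q = vcoset W ` UNIV" by (rule ops)
  obtain A where A': "finite A \<and> A \<subseteq> carrier ?Q \<and> Q.span A = carrier ?Q"
    using fd unfolding Q.fin_dim_def by (elim exE)
  note A = A'[THEN conjunct1] A'[THEN conjunct2, THEN conjunct1, unfolded Q]
    A'[THEN conjunct2, THEN conjunct2, unfolded Q]
  obtain F where F: "finite F" "A = vcoset W ` F"
    using finite_subset_image[OF A(1,2)] by blast
  let ?U = "vcoset W ` span (F \<union> W)"
  have "submodule class_ring ?U ?Q"
  proof
    show "?U \<subseteq> carrier ?Q" "\<zero>\<^bsub>?Q\<^esub> \<in> ?U" unfolding ops using span_zero by auto
    show "X \<oplus>\<^bsub>?Q\<^esub> Y \<in> ?U" if "X \<in> ?U" "Y \<in> ?U" for X Y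
      using that by (auto simp: ops intro: span_add)
    show "c \<odot>\<^bsub>?Q\<^esub> X \<in> ?U" if "c \<in> carrier class_ring" "X \<in> ?U" for c X
      using that by (auto simp: ops intro: span_scale)
  qed
  moreover have "A \<subseteq> ?U" unfolding F(2) by (intro image_mono) (auto intro: span_base)
  ultimately have "vcoset W ` UNIV \<subseteq> ?U" using Q.span_is_subset[of A ?U] A(3) by blast
  then have "\<exists>v\<in>span (F \<union> W). x - v \<in> W" for x
    by (auto simp: vcoset_eq_iff[OF W] image_subset_iff image_iff)
  then have "x \<in> span (F \<union> W)" for x
    by (metis Un_iff diff_add_cancel span_add span_base)
  then show ?thesis using F(1) by blast
qed

end

section \<open>Acyclicity of the quotient complexes\<close>

context leibniz_bimodule
begin

definition relatively_acyclic :: "nat \<Rightarrow> 'm set \<Rightarrow> 'm set \<Rightarrow> bool" where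
  "relatively_acyclic n N N' \<longleftrightarrow>
     (\<forall>h\<in>C (Suc n) N. diff h \<in> C (Suc (Suc n)) N' \<longrightarrow>
        (\<exists>b\<in>C n N. \<exists>c\<in>C (Suc n) N'. h = (\<lambda>xs. diff b xs + c xs)))"

text \<open>Solve for \<open>b\<close> with \<open>lie s b\<close> congruent to the contraction of
  \<open>h\<close> with \<open>s\<close>. By Cartan's formula \<open>lie s\<close> then sends
  \<open>h - diff b\<close> into the cochains of \<open>N'\<close>, and \<open>lie s\<close> is
  injective modulo them.\<close>

lemma relatively_acyclic_step:
  assumes N: "subbimodule N" "subbimodule N'"
    and s: "locally_nilpotent (lmul s)"
    and inj: "\<And>m. m \<in> N \<Longrightarrow> lact s m \<in> N' \<Longrightarrow> m \<in> N'"
    and surj: "\<And>m. m \<in> N \<Longrightarrow> \<exists>m'\<in>N. lact s m' - m \<in> N'"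
  shows "relatively_acyclic n N N'"
  unfolding relatively_acyclic_def
proof (intro ballI impI)
  fix h assume h: "h \<in> C (Suc n) N" and dh: "diff h \<in> C (Suc (Suc n)) N'"
  note NN = subbimoduleD(1)[OF N(1)] and NN' = subbimoduleD(1)[OF N(2)]
  obtain b where b: "b \<in> C n N" and lb: "\<And>ys. lie s b ys - h (s # ys) \<in> N'"
    using lie_surjective_mod[OF N s surj cochain_tail[OF h]] by blast
  have bU: "b \<in> C n UNIV" by (rule cochain_mono[OF b subset_UNIV])
  let ?e = "\<lambda>ys. lie s b ys - h (s # ys)"
  have e: "?e \<in> C n N'"
    by (rule cochain_restrict[where N = N])
      (intro cochain_diff NN cochain_lie N b cochain_tail[OF h] lb)+
  define c where "c = (\<lambda>xs. h xs - diff b xs)"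
  have c: "c \<in> C (Suc n) N"
    unfolding c_def by (intro cochain_diff NN h diff_cochain N b)
  \<comment> \<open>Cartan's formula expands \<open>lie s h\<close>, and \<open>lie s\<close>
    commutes with \<open>diff\<close> on \<open>b\<close>; the contraction of \<open>h\<close> and
    \<open>lie s b\<close> combine to the error \<open>?e\<close>.\<close>
  have "lie s c = (\<lambda>ys. diff h (s # ys) - diff ?e ys)"
    unfolding c_def lie_diff diff_minus diff_Cons[OF h] diff_lie[OF bU] by simp
  moreover have "(\<lambda>ys. diff h (s # ys) - diff ?e ys) \<in> C (Suc n) N'"
    by (intro cochain_diff NN' cochain_tail[OF dh] diff_cochain N e)
  ultimately have "c \<in> C (Suc n) N'"
    using lie_injective_mod[OF N s inj c] by simp
  moreover have "h = (\<lambda>xs. diff b xs + c xs)" by (simp add: c_def)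
  ultimately show "\<exists>b\<in>C n N. \<exists>c\<in>C (Suc n) N'. h = (\<lambda>xs. diff b xs + c xs)"
    using b by blast
qed

text \<open>The correction \<open>c\<close> from the first step has the same differential as
  \<open>h\<close>, so the second step applies to it; the two primitives add.\<close>

lemma relatively_acyclic_trans:
  assumes 1: "relatively_acyclic n N N'" and 2: "relatively_acyclic n N' N''"
    and N: "subbimodule N" "N' \<subseteq> N" "N'' \<subseteq> N'"
  shows "relatively_acyclic n N N''"
  unfolding relatively_acyclic_def
proof (intro ballI impI)
  fix h assume h: "h \<in> C (Suc n) N" and dh: "diff h \<in> C (Suc (Suc n)) N''"
  obtain b c where b: "b \<in> C n N" and c: "c \<in> C (Suc n) N'" and h_eq: "h = (\<lambda>xs. diff b xs + c xs)"
    using 1 h cochain_mono[OF dh N(3)] unfolding relatively_acyclic_def by blast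
  have "diff h xs = diff c xs" for xs
    unfolding h_eq diff_add diff_diff[OF cochain_mono[OF b subset_UNIV]] by simp
  then have "diff c = diff h" by auto
  then obtain b' c' where b': "b' \<in> C n N'" and c': "c' \<in> C (Suc n) N''"
    and c_eq: "c = (\<lambda>xs. diff b' xs + c' xs)"
    using 2 c dh unfolding relatively_acyclic_def by metis
  have "(\<lambda>xs. b xs + b' xs) \<in> C n N"
    by (intro cochain_add subbimoduleD(1)[OF N(1)] b cochain_mono[OF b' N(2)])
  moreover have "h = (\<lambda>xs. diff (\<lambda>xs. b xs + b' xs) xs + c' xs)"
    unfolding h_eq c_eq diff_add by (simp add: add.assoc)
  ultimately show "\<exists>b\<in>C n N. \<exists>c\<in>C (Suc n) N''. h = (\<lambda>xs. diff b xs + c xs)"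
    using c' by blast
qed

lemma relatively_acyclic_refl:
  assumes "subbimodule N"
  shows "relatively_acyclic n N N"
proof -
  have "h = (\<lambda>xs. diff (\<lambda>xs. 0) xs + h xs)" for h
    using diff_scale[of 0 "\<lambda>xs. 0"] by simp
  moreover have "(\<lambda>xs. 0) \<in> C n N"
    using cochain_zero M.subspace_0 subbimoduleD(1)[OF assms] by blast
  ultimately show ?thesis unfolding relatively_acyclic_def by blast
qed

lemma relatively_acyclic_fitting_null_set:
  assumes S: "\<forall>s\<in>S. locally_nilpotent (lmul s)"
    and F: "finite F" "M.span (F \<union> fitting_null_set lact S) = UNIV"
    and N: "subbimodule N" "fitting_null_set lact S \<subseteq> N"
  shows "relatively_acyclic n N (fitting_null_set lact S)"
proof -
  let ?N0 = "fitting_null_set lact S"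
  obtain p where p: "Vector_Spaces.linear scaleM scaleM p" "\<And>x. x \<in> ?N0 \<Longrightarrow> p x = 0"
    "\<And>x. x - p x \<in> ?N0"
    by (rule M.projection_along_subspace[OF subbimoduleD(1)[OF subbimodule_fitting_null_set[OF S]]]) blast
  have pF: "p ` A \<subseteq> M.span (p ` F)" for A
    using M.span_Un_kernel[OF p(1,2)] F(2) by blast
  show ?thesis
    using N
  \<comment> \<open>The kernel of \<open>p\<close> is \<open>?N0\<close>, so the measure is the
    codimension of \<open>?N0\<close> in \<open>N\<close>, which is finite even if \<open>N\<close>
    has infinite dimension.\<close>
  proof (induction N rule: measure_induct_rule[of "\<lambda>N. M.dim (p ` N)"])
    case (less N)
    show ?case
    proof (cases "N = ?N0")
      case True
      then show ?thesis using relatively_acyclic_refl less.prems by simp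
    next
      case False
      then obtain m s where m: "m \<in> N" "s \<in> S" "m \<notin> fitting_null (lact s)"
        using less.prems unfolding fitting_null_set_def by blast
      have s: "locally_nilpotent (lmul s)" using S m(2) by blast
      define N' where "N' = N \<inter> fitting_null (lact s)"
      have N': "subbimodule N'"
        unfolding N'_def by (intro subbimodule_Int subbimodule_fitting_null s less.prems)
      note sub = subbimoduleD(1)[OF less.prems(1)] subbimoduleD(1)[OF N']
      have N0: "?N0 \<subseteq> N'" using less.prems(2) m(2) unfolding N'_def fitting_null_set_def by blast
      \<comment> \<open>\<open>N'\<close> contains the kernel of \<open>p\<close>, so it can be
        recovered inside \<open>N\<close> from its image, and the proper inclusion survives applying
        \<open>p\<close>.\<close>
      have "m' \<in> N'" if m': "m' \<in> N" "p m' \<in> p ` N'" for m'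
      proof -
        obtain k where k: "k \<in> N'" "p m' = p k" using m'(2) by blast
        then have "m' - k \<in> ?N0" using p(3)[of "m' - k"] M.linear_simps(5)[OF p(1)] by simp
        then show ?thesis using M.subspace_add[OF sub(2) k(1), of "m' - k"] N0 by auto
      qed
      then have "p ` N' \<subset> p ` N" using m unfolding N'_def by blast
      then have "M.dim (p ` N') < M.dim (p ` N)"
        by (intro M.dim_strict_mono[of _ _ "p ` F"] M.subspace_linear_image p(1) sub pF finite_imageI F(1))
      then have IH: "relatively_acyclic n N' ?N0" using less.IH N' N0 by blast
      have inj: "m \<in> N'" if "m \<in> N" "lact s m \<in> N'" for m
        using that fitting_null_lactD unfolding N'_def by blast
      have "N \<subseteq> M.span (F \<union> N')"
        using F(2) M.span_mono[of "F \<union> ?N0" "F \<union> N'"] N0 by blast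
      then have surj: "\<exists>m'\<in>N. lact s m' - m \<in> N'" if "m \<in> N" for m
        by (intro M.surjective_mod_subspace[OF linear_lact_module sub _ _ F(1)] that)
          (use inj subbimoduleD(2)[OF less.prems(1)] in auto)
      have "relatively_acyclic n N N'"
        by (rule relatively_acyclic_step[OF less.prems(1) N' s inj surj])
      then show ?thesis
        by (rule relatively_acyclic_trans[OF _ IH less.prems(1) _ N0]) (auto simp: N'_def)
    qed
  qed
qed

section \<open>Comparison of the cohomology spaces\<close>

abbreviation "scaleC \<equiv> (\<lambda>c f xs. scaleM c (f xs))"
abbreviation "Z n N \<equiv> cocycles scaleL lmul scaleM lact ract n N"
abbreviation "B n N \<equiv> coboundaries scaleL lmul scaleM lact ract n N"

lemma vector_space_cochains: "Vector_Spaces.vector_space scaleC"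
  by unfold_locales (simp_all add: fun_eq_iff M.scale_right_distrib M.scale_left_distrib)

lemma cocycle_iff: "f \<in> Z n N \<longleftrightarrow> f \<in> C n N \<and> (\<forall>xs. diff f xs = 0)"
  unfolding cocycles_def using leibniz_d_eq_diff[of f n N] by (auto simp: fun_eq_iff)

lemma coboundaries_0: "B 0 N = {0}"
  by (simp add: coboundaries_def)

lemma coboundaries_Suc: "B (Suc n) N = diff ` C n N"
  by (simp add: coboundaries_def leibniz_d_eq_diff cong: image_cong)

lemma subspace_cocycles:
  assumes N: "M.subspace N"
  shows "Modules.module.subspace scaleC (Z n N)"
proof -
  interpret c: Vector_Spaces.vector_space scaleC by (rule vector_space_cochains)
  have z: "diff (\<lambda>xs. 0) xs = 0" for xs using diff_scale[of 0 "\<lambda>xs. 0" xs] by simp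
  show ?thesis
    using cochain_zero[OF M.subspace_0[OF N], of n] cochain_add[OF N] cochain_scale[OF N]
    by (auto intro!: c.subspaceI simp: cocycle_iff plus_fun_def zero_fun_def diff_add diff_scale z)
qed

lemma subspace_coboundaries:
  assumes N: "M.subspace N"
  shows "Modules.module.subspace scaleC (B n N)"
proof -
  interpret c: Vector_Spaces.vector_space scaleC by (rule vector_space_cochains)
  show ?thesis
  proof (cases n)
    case 0
    then show ?thesis by (simp add: coboundaries_0)
  next
    case (Suc k)
    have "c.subspace (C k N)"
      using cochain_zero[OF M.subspace_0[OF N], of k] cochain_add[OF N] cochain_scale[OF N]
      by (auto intro!: c.subspaceI simp: plus_fun_def zero_fun_def)
    moreover have "Vector_Spaces.linear scaleC scaleC diff"
      unfolding c.linear_scale_iff by (auto simp: fun_eq_iff plus_fun_def diff_add diff_scale)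
    ultimately show ?thesis unfolding Suc coboundaries_Suc by (intro c.subspace_linear_image)
  qed
qed

lemma cocycles_mono: "N \<subseteq> N' \<Longrightarrow> Z n N \<subseteq> Z n N'"
  by (auto simp: cocycle_iff intro: cochain_mono)

lemma coboundaries_mono: "N \<subseteq> N' \<Longrightarrow> B n N \<subseteq> B n N'"
  by (cases n) (auto simp: coboundaries_0 coboundaries_Suc intro: cochain_mono)

lemma coboundaries_subset_cocycles:
  assumes N: "subbimodule N"
  shows "B n N \<subseteq> Z n N"
proof (cases n)
  case 0
  interpret c: Vector_Spaces.vector_space scaleC by (rule vector_space_cochains)
  have "0 \<in> Z 0 N" by (intro c.subspace_0 subspace_cocycles subbimoduleD(1)[OF N])
  then show ?thesis by (simp add: 0 coboundaries_0)
next
  case (Suc k)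
  then show ?thesis
    by (auto simp: coboundaries_Suc cocycle_iff
        intro: diff_cochain[OF N] diff_diff[OF cochain_mono[OF _ subset_UNIV]])
qed

text \<open>\<open>surj\<close> and \<open>inj\<close> make the map on cohomology induced by the
  inclusion of \<open>N\<close> onto and one-to-one; the second isomorphism theorem packages
  this.\<close>

lemma HL_isomorphic:
  assumes N: "subbimodule N"
    and surj: "\<And>z. z \<in> Z n UNIV \<Longrightarrow> \<exists>c\<in>Z n N. z - c \<in> B n UNIV"
    and inj: "B n UNIV \<inter> Z n N \<subseteq> B n N"
  shows "vs_isomorphic (HL scaleL lmul scaleM lact ract n UNIV) (HL scaleL lmul scaleM lact ract n N)"
proof -
  interpret c: Vector_Spaces.vector_space scaleC by (rule vector_space_cochains)
  have "B n UNIV \<inter> Z n N = B n N"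
    using inj coboundaries_mono[of N UNIV n] coboundaries_subset_cocycles[OF N, of n] by auto
  then show ?thesis
    unfolding HL_def
    by (intro c.vs_isomorphic_quotient_space subspace_cocycles subspace_coboundaries
        subbimoduleD(1)[OF N] M.subspace_UNIV cocycles_mono subset_UNIV surj)
qed

text \<open>Part of the long exact sequence: acyclicity in degree n + 1 gives surjectivity, and
  \<open>inj\<close> says that the connecting map out of degree n vanishes.\<close>

lemma HL_Suc_isomorphic:
  assumes N: "subbimodule N" and ac: "relatively_acyclic n UNIV N"
    and inj: "\<And>h. h \<in> C n UNIV \<Longrightarrow> diff h \<in> C (Suc n) N \<Longrightarrow> \<exists>c\<in>C n N. diff h = diff c"
  shows "vs_isomorphic (HL scaleL lmul scaleM lact ract (Suc n) UNIV)
    (HL scaleL lmul scaleM lact ract (Suc n) N)"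
proof (rule HL_isomorphic[OF N])
  fix z assume z: "z \<in> Z (Suc n) UNIV"
  then have "diff z = (\<lambda>xs. 0)" by (auto simp: cocycle_iff)
  then have "diff z \<in> C (Suc (Suc n)) N"
    using cochain_zero[OF M.subspace_0[OF subbimoduleD(1)[OF N]]] by simp
  then obtain b c where b: "b \<in> C n UNIV" and c: "c \<in> C (Suc n) N"
    and z_eq: "z = (\<lambda>xs. diff b xs + c xs)"
    using ac z unfolding relatively_acyclic_def cocycle_iff by blast
  have "diff c xs = 0" for xs
    using z unfolding cocycle_iff z_eq diff_add diff_diff[OF b] by simp
  then have "c \<in> Z (Suc n) N" using c by (simp add: cocycle_iff)
  moreover have "z - c = diff b" by (simp add: z_eq fun_eq_iff)
  ultimately show "\<exists>c\<in>Z (Suc n) N. z - c \<in> B (Suc n) UNIV"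
    using b unfolding coboundaries_Suc by blast
next
  show "B (Suc n) UNIV \<inter> Z (Suc n) N \<subseteq> B (Suc n) N"
    unfolding coboundaries_Suc
  proof safe
    fix h assume "h \<in> C n UNIV" "diff h \<in> Z (Suc n) N"
    then show "diff h \<in> diff ` C n N" using inj[of h] unfolding cocycle_iff by blast
  qed
qed

text \<open>\<open>h\<close> and \<open>c\<close> differ by a coboundary. This provides the
  assumption \<open>inj\<close> of \<open>HL_Suc_isomorphic\<close> in positive degree.\<close>

lemma relatively_acyclic_imp_diff_eq:
  assumes "relatively_acyclic n UNIV N" "h \<in> C (Suc n) UNIV" "diff h \<in> C (Suc (Suc n)) N"
  shows "\<exists>c\<in>C (Suc n) N. diff h = diff c"
proof -
  obtain b c where b: "b \<in> C n UNIV" and c: "c \<in> C (Suc n) N" and h: "h = (\<lambda>xs. diff b xs + c xs)"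
    using assms unfolding relatively_acyclic_def by blast
  have "diff h = diff c"
    unfolding h by (rule ext) (simp add: diff_add diff_diff[OF b])
  then show ?thesis using c by blast
qed

text \<open>Symmetry turns \<open>diff h [x]\<close> into \<open>lact x (h [])\<close>. Taking each
  \<open>s\<close> in \<open>S\<close> for \<open>x\<close> and cancelling it by
  \<open>fitting_null_lactD\<close> puts \<open>h []\<close> in every null component.\<close>

lemma symmetric_cochain_0:
  assumes sym: "symmetric_bimodule lact ract" and h: "h \<in> C 0 UNIV"
    and dh: "\<And>x. diff h [x] \<in> fitting_null_set lact S"
  shows "h \<in> C 0 (fitting_null_set lact S)"
proof -
  have "lact x (h []) \<in> fitting_null_set lact S" for x
    using dh[of x] sym by (simp add: symmetric_bimodule_def)
  then have "h [] \<in> fitting_null_set lact S"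
    unfolding fitting_null_set_def using fitting_null_lactD by blast
  then show ?thesis using h by (simp add: cochain_0_iff)
qed

end

theorem theorem3p3:
  fixes scaleL :: "'f::field \<Rightarrow> 'l::ab_group_add \<Rightarrow> 'l"
    and lmul :: "'l \<Rightarrow> 'l \<Rightarrow> 'l"
    and scaleM :: "'f \<Rightarrow> 'm::ab_group_add \<Rightarrow> 'm"
    and lact :: "'l \<Rightarrow> 'm \<Rightarrow> 'm"
    and ract :: "'m \<Rightarrow> 'l \<Rightarrow> 'm"
    and S :: "'l set"
  assumes "leibniz_bimodule scaleL lmul scaleM lact ract"
    and "\<forall>s\<in>S. locally_nilpotent (lmul s)"
    and "vectorspace.fin_dim class_ring
           (quotient_space scaleM UNIV (fitting_null_set lact S))"
  shows "(\<forall>n\<ge>2. vs_isomorphic (HL scaleL lmul scaleM lact ract n UNIV)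
                   (HL scaleL lmul scaleM lact ract n (fitting_null_set lact S))) \<and>
         (symmetric_bimodule lact ract \<longrightarrow>
           (\<forall>n. vs_isomorphic (HL scaleL lmul scaleM lact ract n UNIV)
                  (HL scaleL lmul scaleM lact ract n (fitting_null_set lact S))))"
proof -
  interpret leibniz_bimodule scaleL lmul scaleM lact ract by fact
  let ?N = "fitting_null_set lact S"
  let ?iso = "\<lambda>n. vs_isomorphic (HL scaleL lmul scaleM lact ract n UNIV)
    (HL scaleL lmul scaleM lact ract n ?N)"
  have N: "subbimodule ?N" by (rule subbimodule_fitting_null_set) fact
  obtain F where F: "finite F" "M.span (F \<union> ?N) = UNIV"
    using M.finite_codimension_span[OF subbimoduleD(1)[OF N] assms(3)] by blast
  have ac: "relatively_acyclic n UNIV ?N" for n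
    by (rule relatively_acyclic_fitting_null_set[OF assms(2) F subbimodule_UNIV subset_UNIV])
  \<comment> \<open>Acyclicity is used twice, in degree n + 2 for surjectivity and in degree n + 1
    for injectivity; hence the bound 2.\<close>
  have ge2: "?iso (Suc (Suc n))" for n
    by (rule HL_Suc_isomorphic[OF N ac]) (rule relatively_acyclic_imp_diff_eq[OF ac])
  moreover have "?iso n" if sym: "symmetric_bimodule lact ract" for n
  proof -
    \<comment> \<open>The only coboundary is 0, so the claim is that every degree-zero cocycle has
      its value in \<open>?N\<close>.\<close>
    have "?iso 0"
    proof (rule HL_isomorphic[OF N])
      fix z assume z: "z \<in> Z 0 UNIV"
      have "z \<in> C 0 ?N"
      proof (rule symmetric_cochain_0[OF sym])
        show "z \<in> C 0 UNIV" using z by (simp add: cocycle_iff)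
        show "diff z [x] \<in> ?N" for x
          using z M.subspace_0[OF subbimoduleD(1)[OF N]] unfolding cocycle_iff by metis
      qed
      then show "\<exists>c\<in>Z 0 ?N. z - c \<in> B 0 UNIV"
        using z by (intro bexI[of _ z]) (simp_all add: cocycle_iff coboundaries_0)
    qed (simp add: coboundaries_0)
    \<comment> \<open>Surjectivity still comes from acyclicity in degree one; for injectivity,
      symmetry takes the place of acyclicity in degree zero.\<close>
    moreover have "?iso (Suc 0)"
    proof (rule HL_Suc_isomorphic[OF N ac])
      fix h assume h: "h \<in> C 0 UNIV" "diff h \<in> C (Suc 0) ?N"
      have "diff h [x] \<in> ?N" for x by (rule cochain_mem[OF h(2)]) simp
      then have "h \<in> C 0 ?N" by (rule symmetric_cochain_0[OF sym h(1)])
      then show "\<exists>c\<in>C 0 ?N. diff h = diff c" by blast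
    qed
    ultimately show ?thesis using ge2 by (metis not0_implies_Suc)
  qed
  moreover have "?iso n" if "n \<ge> 2" for n
  proof -
    have "n = Suc (Suc (n - 2))" using that by simp
    then show ?thesis using ge2 by metis
  qed
  ultimately show ?thesis by blast
qed

end
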